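(* Let $m\geq 3$ and let $\chi_1,\chi_2$ be multiplicative characters modulo $2^m$ with $\chi_2$ primitive. Let $A,B,k$ be integers with $k\geq 1$, $A$ even and $B$ odd, and write $$A=2^nA_1,\ n>0,\qquad k=2^tk_1,\qquad 2\nmid A_1k_1B,$$ and set $$S=\sum_{x=1}^{2^m}\chi_1(x)\chi_2(Ax^k+B).$$ Let $c_1,c_2$ be the integers with $\chi_i(5)=e_{2^{m-2}}(c_i)$ and $1\leq c_i\leq 2^{m-2}$ ($i=1,2$), where $e_q(x)=e^{2\pi i x/q}$. For $i\geq 2$ let $R_i$ be the odd integer defined by $5^{2^{i-2}}=1+R_i2^i$. Define $$N:=\begin{cases}\lceil \tfrac12(m-n)\rceil, & \text{if } m-n>2t+4,\\ t+2, & \text{if } t+2\leq m-n\leq 2t+4,\end{cases}$$ and $$C(x):=c_1(Ax^k+B)+c_2Akx^kR_NR_{N+n}^{-1},$$ where $R_{N+n}^{-1}$ denotes the inverse of $R_{N+n}$ modulo $2^m$. By the characteristic equation we mean the congruence $$C(x_0)\equiv 0 \pmod{2^{\lfloor \frac12(m+n)\rfloor+t}}$$ in an integer $x_0$ with $2\nmid x_0(Ax_0^k+B)$. Suppose that $m-n\geq t+2$. Then $S=0$ unless all of the following hold: $c_1=2^{n+t}c_3$ with $c_3$ an odd integer; $\chi_1(-1)=1$ if $k$ is even; and, when $m-n>2t+4$, the characteristic equation has an odd solution $x_0$. Assume these conditions hold. Then: (i) If $m-n>2t+4$, let $x_0$ be an odd solution of the characteristic equation, write $C(x_0)=\lambda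 2^{\lfloor\frac12(m+n)\rfloor+t}$ with $\lambda\in\mathbb Z$, and put $h:=2\lambda+(k_1-1)+(2^n-1)c_3$. Then $$S=2^{\frac12(m+n)+t+\min\{1,t\}}\chi_1(x_0)\chi_2(Ax_0^k+B)\cdot\begin{cases}1, & \text{if } m-n \text{ is even},\\ \omega^h\left(\frac{2}{h}\right), & \text{if } m-n \text{ is odd},\end{cases}$$ where $\omega=e^{\pi i/4}$ and $\left(\frac{2}{h}\right)$ is the Jacobi symbol. (ii) If $t+3<m-n\leq 2t+4$, then $$S=\begin{cases}2^{m-1}\chi_2(A+B), & \text{if } k \text{ is even and } C(1)\equiv 0 \bmod 2^{m-2},\\ 2^{m-2}\chi_2(A+B), & \text{if } k \text{ is odd and } C(1)\equiv 0 \bmod 2^{m-2},\\ 2^{m-2}\chi_1(-1)\chi_2(-A+B), & \text{if } k \text{ is odd and } C(-1)\equiv 0 \bmod 2^{m-2},\\ 0, & \text{otherwise}.\end{cases}$$ (iii) If $m-n=t+3$, then $$S=\begin{cases}2^{m-1}\chi_2(A+B), & \text{if } k \text{ is even and } \chi_1(5)=\pm1,\ \chi_1(-1)=1,\\ 2^{m-2}\bigl(\chi_2(A+B)+\chi_1(-1)\chi_2(-A+B)\bigr), & \text{if } k \text{ is odd and } \chi_1(5)=\pm 1,\\ 0, & \text{otherwise}.\end{cases}$$ (iv) If $m-n=t+2$, then $$S=\begin{cases}2^{m-1}\chi_2(A+B), & \text{if } k \text{ is even and } \chi_1=\chi_0, \text{ or } k \text{ is odd and } \chi_1=\chi_4,\\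 0, & \text{otherwise},\end{cases}$$ where $\chi_0$ is the principal character modulo $2^m$ and $\chi_4$ is the character modulo $2^m$ induced by the non-trivial character modulo $4$ (i.e. $\chi_4(x)=\pm1$ according as $x\equiv\pm1 \bmod 4$).
   Context: Characters modulo $2^m$ are extended by $\chi(x)=0$ for even $x$. Since $(\mathbb Z/2^m\mathbb Z)^*$ is generated by $-1$ and $5$, with $5$ of order $2^{m-2}$, each character mod $2^m$ is determined by its values at $-1$ and $5$; primitivity of $\chi_2$ means $c_2$ is odd. Throughout, $y^{-1}$ denotes the inverse of an odd integer $y$ modulo $2^m$. *)

theory Defs
  imports "HOL-Analysis.Analysis" "HOL-Number_Theory.Number_Theory"
begin

definition dchar :: "int \<Rightarrow> (int \<Rightarrow> complex) \<Rightarrow> bool" where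
  "dchar q chi \<longleftrightarrow> q > 0 \<and> chi 1 = 1 \<and>
     (\<forall>x y. chi (x * y) = chi x * chi y) \<and>
     (\<forall>x. chi (x + q) = chi x) \<and>
     (\<forall>x. \<not> coprime x q \<longrightarrow> chi x = 0)"

definition primitive_dchar :: "int \<Rightarrow> (int \<Rightarrow> complex) \<Rightarrow> bool" where
  "primitive_dchar q chi \<longleftrightarrow> dchar q chi \<and>
     (\<forall>d. d > 0 \<and> d dvd q \<and> d < q \<longrightarrow>
        (\<exists>x. coprime x q \<and> [x = 1] (mod d) \<and> chi x \<noteq> 1))"

definition chi0_2 :: "int \<Rightarrow> complex" where
  "chi0_2 x = (if odd x then 1 else 0)"

definition chi4 :: "int \<Rightarrow> complex" where
  "chi4 x = (if odd x then (if x mod 4 = 1 then 1 else -1) else 0)"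

definition eq :: "int \<Rightarrow> int \<Rightarrow> complex" where
  "eq q x = exp (2 * pi * \<i> * of_int x / of_int q)"

text \<open>R_i defined by 5^(2^(i-2)) = 1 + R_i 2^i (for i \<ge> 2).\<close>
definition R :: "nat \<Rightarrow> int" where
  "R i = (5 ^ (2 ^ (i - 2)) - 1) div 2 ^ i"

text \<open>Jacobi symbol (a/n), n odd; for negative n we use |n| (Kronecker convention).\<close>
definition jacobi :: "int \<Rightarrow> int \<Rightarrow> int" where
  "jacobi a n = (\<Prod>p\<in>prime_factors (nat \<bar>n\<bar>). Legendre a (int p) ^ multiplicity p (nat \<bar>n\<bar>))"

end

theory Submission
  imports Defs
begin

text \<open>
Write \<open>f x = \<chi>\<^sub>1 x * \<chi>\<^sub>2 (A x\<^sup>k + B)\<close>, \<open>j = N - t\<close> and \<open>u = 5^(2^(j-2))\<close>, a generator of the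
residues congruent to 1 modulo \<open>2^j\<close>. The choice of \<open>N\<close> makes the binomial expansion of \<open>u^(ks)\<close>
linear in \<open>s\<close> modulo \<open>2^(m-n)\<close>, so \<open>f (a u^s) = f a * \<zeta>^s\<close>, where \<open>\<zeta>\<close> is a root of unity of order
dividing \<open>2^(m-j)\<close> which equals 1 exactly when \<open>C a \<equiv> 0 (mod 2^(m-j))\<close>. Hence the sum of \<open>f\<close> over
a residue class \<open>a\<close> modulo \<open>2^j\<close> is \<open>2^(m-j) f a\<close> or 0, and only the classes that solve the
characteristic equation survive. For \<open>m - n \<le> 2t + 4\<close> one has \<open>j = 2\<close>, and the classes are those of 1
and -1. For \<open>m - n > 2t + 4\<close> the characteristic equation fixes \<open>x^k\<close> modulo \<open>2^(m-n-N)\<close>, so its solutions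
are \<open>\<plusminus>x\<^sub>0\<close> modulo \<open>2^(m-n-N-t)\<close>. When \<open>m - n\<close> is even this modulus is \<open>2^j\<close>. When \<open>m - n\<close> is odd it is
\<open>2^(j-1)\<close>, a second class \<open>x\<^sub>0 v\<close> with \<open>v\<^sup>2 = u\<close> appears, and \<open>f (x\<^sub>0 v) = \<i>^h f x\<^sub>0\<close>; the factor of the
theorem comes from \<open>1 + \<i>^h = sqrt 2 * \<omega>^h * (2/h)\<close>.
\<close>

subsection \<open>Additive characters and powers of 5\<close>

lemma eq_add: "eq q (x + y) = eq q x * eq q y"
  by (simp add: eq_def exp_add[symmetric] add_divide_distrib ring_distribs)

lemma eq_0 [simp]: "eq q 0 = 1"
  by (simp add: eq_def)

lemma eq_power: "eq q x ^ s = eq q (int s * x)"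
  by (induction s) (simp_all add: eq_add ring_distribs)

lemma eq_eq_1_iff:
  assumes "q > 0"
  shows "eq q x = 1 \<longleftrightarrow> q dvd x"
proof -
  have "eq q x = exp (\<i> * complex_of_real (2 * pi * real_of_int x / real_of_int q))"
    by (simp add: eq_def mult_ac)
  then have "eq q x = 1 \<longleftrightarrow> (\<exists>n::int. 2 * pi * real_of_int x / real_of_int q = real_of_int (2 * n) * pi)"
    by (simp only: exp_eq_1 Re_i_times Im_i_times Re_complex_of_real Im_complex_of_real) simp
  also have "\<dots> \<longleftrightarrow> (\<exists>n::int. real_of_int x = real_of_int (n * q))"
    using assms by (intro ex_cong1) (auto simp: field_simps)
  also have "\<dots> \<longleftrightarrow> q dvd x"
    unfolding of_int_eq_iff by (auto simp: dvd_def mult.commute)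
  finally show ?thesis .
qed

lemma eq_cong:
  assumes "q > 0" "[x = y] (mod q)"
  shows "eq q x = eq q y"
proof -
  have "eq q (x - y) = 1"
    using assms by (simp add: eq_eq_1_iff cong_iff_dvd_diff)
  then show ?thesis
    using eq_add[of q "x - y" y] by simp
qed

lemma eq_mult_cancel:
  assumes "d \<noteq> 0"
  shows "eq (q * d) (x * d) = eq q x"
  using assms by (simp add: eq_def mult.assoc)

lemma eq_power2_cancel: "i \<le> l \<Longrightarrow> eq (2 ^ l) (2 ^ i * x) = eq (2 ^ (l - i)) x"
  using eq_mult_cancel[of "2 ^ i" "2 ^ (l - i)" x]
  by (simp add: power_add[symmetric] mult.commute)

text \<open>Orthogonality: a geometric series whose ratio is a \<open>Q\<close>-th root of unity.
  This is why a class sum is either full or zero.\<close>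

lemma sum_eq_multiples:
  fixes Q :: nat
  assumes "Q > 0"
  shows "(\<Sum>s<Q. eq (int Q) (int s * x)) = (if int Q dvd x then of_nat Q else 0)"
proof (cases "int Q dvd x")
  case True
  then have "eq (int Q) (int s * x) = 1" for s
    using assms by (simp add: eq_eq_1_iff)
  then show ?thesis using True by simp
next
  case False
  have "eq (int Q) x \<noteq> 1" "eq (int Q) x ^ Q = 1"
    using False assms by (simp_all add: eq_eq_1_iff eq_power)
  then have "(\<Sum>s<Q. eq (int Q) x ^ s) = 0"
    by (simp add: geometric_sum)
  then show ?thesis using False by (simp add: eq_power)
qed

text \<open>Squaring \<open>1 + r * 2 ^ i\<close> adds \<open>r ^ 2 * 2 ^ (i - 1)\<close> to the
  coefficient, which is even for \<open>i >= 2\<close>, so oddness is inherited. In particular the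
  division in the definition of \<open>R\<close> is exact.\<close>

lemma R_expansion_odd:
  assumes "i \<ge> 2"
  shows "5 ^ (2 ^ (i - 2)) = 1 + R i * 2 ^ i \<and> odd (R i)"
proof -
  have "\<exists>r::int. odd r \<and> 5 ^ (2 ^ (i - 2)) = 1 + r * 2 ^ i"
    using assms
  proof (induction i rule: dec_induct)
    case base
    show ?case by (intro exI[of _ 1]) simp
  next
    case (step i)
    then obtain r :: int where r: "odd r" "5 ^ (2 ^ (i - 2)) = 1 + r * 2 ^ i" by blast
    have i: "i = Suc (i - 1)" "Suc i - 2 = Suc (i - 2)" "i - 1 > 0" using step.hyps by auto
    have "(5::int) ^ (2 ^ (Suc i - 2)) = (1 + r * 2 ^ i) ^ 2"
      unfolding i(2) r(2)[symmetric] by (simp add: power_mult[symmetric] mult.commute)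
    also have "\<dots> = 1 + (r + r ^ 2 * 2 ^ (i - 1)) * 2 ^ Suc i"
      by (subst (1 2) i(1)) (simp add: power2_eq_square algebra_simps)
    finally show ?case using r(1) i(3) by (intro exI[of _ "r + r ^ 2 * 2 ^ (i - 1)"]) simp
  qed
  then show ?thesis by (auto simp: R_def)
qed

lemmas R_expansion = R_expansion_odd[THEN conjunct1]
lemmas odd_R = R_expansion_odd[THEN conjunct2]

lemma R_Suc:
  assumes "i \<ge> 2"
  shows "R (Suc i) = R i + R i ^ 2 * 2 ^ (i - 1)"
proof -
  have i: "i = Suc (i - 1)" "Suc i - 2 = Suc (i - 2)" using assms by auto
  have "1 + R (Suc i) * 2 ^ Suc i = (1 + R i * 2 ^ i) ^ 2"
    using R_expansion[of "Suc i"] assms unfolding i(2) R_expansion[OF assms, symmetric]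
    by (simp add: power_mult[symmetric] mult.commute)
  also have "\<dots> = 1 + (R i + R i ^ 2 * 2 ^ (i - 1)) * 2 ^ Suc i"
    by (subst (2 4) i(1)) (simp add: power2_eq_square algebra_simps)
  finally show ?thesis by simp
qed

text \<open>\<open>R 3 = 3\<close>, and from there on the term added by \<open>R_Suc\<close> is
  divisible by 4. The bound on \<open>i\<close> excludes \<open>R 2 = 1\<close>.\<close>

lemma R_mod_4:
  assumes "i \<ge> 3"
  shows "[R i = 3] (mod 4)"
  using assms
proof (induction i rule: dec_induct)
  case base
  show ?case by (simp add: R_def cong_def)
next
  case (step i)
  then have "i - 1 = 2 + (i - 3)" by simp
  then have "(2::int) ^ (i - 1) = 4 * 2 ^ (i - 3)"
    by (metis power_add power2_eq_square numeral_Bit0 mult_2)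
  then have "R (Suc i) = R i + 4 * (R i ^ 2 * 2 ^ (i - 3))"
    using R_Suc[of i] step.hyps by simp
  then show ?case using step.IH by (simp add: cong_def)
qed

section \<open>Truncated binomial expansions\<close>

lemma one_plus_power_cong2: "[(1 + x) ^ s = 1 + of_nat s * x] (mod x ^ 2)" for x :: int
proof (induction s)
  case (Suc s)
  have "[(1 + x) * (1 + x) ^ s = (1 + x) * (1 + of_nat s * x)] (mod x ^ 2)"
    by (rule cong_scalar_left[OF Suc.IH])
  also have "(1 + x) * (1 + of_nat s * x) = 1 + of_nat (Suc s) * x + x ^ 2 * of_nat s"
    by (simp add: algebra_simps power2_eq_square)
  also have "[\<dots> = 1 + of_nat (Suc s) * x] (mod x ^ 2)"
    by (simp add: cong_def)
  finally show ?case by simp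
qed simp

lemma one_plus_power_cong3:
  "[(1 + x) ^ s = 1 + of_nat s * x + of_nat (s choose 2) * x ^ 2] (mod x ^ 3)" for x :: int
proof (induction s)
  case (Suc s)
  have "[(1 + x) * (1 + x) ^ s = (1 + x) * (1 + of_nat s * x + of_nat (s choose 2) * x ^ 2)] (mod x ^ 3)"
    by (rule cong_scalar_left[OF Suc.IH])
  also have "(1 + x) * (1 + of_nat s * x + of_nat (s choose 2) * x ^ 2) =
      1 + of_nat (Suc s) * x + of_nat (Suc s choose 2) * x ^ 2 + x ^ 3 * of_nat (s choose 2)"
    by (simp add: algebra_simps power2_eq_square power3_eq_cube numeral_2_eq_2)
  also have "[\<dots> = 1 + of_nat (Suc s) * x + of_nat (Suc s choose 2) * x ^ 2] (mod x ^ 3)"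
    by (simp add: cong_def)
  finally show ?case by simp
qed (simp add: numeral_2_eq_2)

lemma cong_power2_mult:
  fixes a b :: int
  assumes "[a = b] (mod 2 ^ l)" "m \<le> i + l"
  shows "[2 ^ i * a = 2 ^ i * b] (mod 2 ^ m)"
proof -
  have "2 ^ i * 2 ^ l dvd 2 ^ i * (a - b)"
    using assms(1) by (intro mult_dvd_mono) (auto simp: cong_iff_dvd_diff)
  then have "2 ^ m dvd 2 ^ i * (a - b)"
    using assms(2) by (metis power_add power_le_dvd)
  then show ?thesis by (simp add: cong_iff_dvd_diff right_diff_distrib)
qed

subsection \<open>Characters modulo powers of two\<close>

lemma dchar_mult: "dchar q chi \<Longrightarrow> chi (x * y) = chi x * chi y"
  by (simp add: dchar_def)

lemma dchar_1: "dchar q chi \<Longrightarrow> chi 1 = 1"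
  by (simp add: dchar_def)

lemma dchar_power: "dchar q chi \<Longrightarrow> chi (x ^ s) = chi x ^ s"
  by (induction s) (simp_all add: dchar_mult dchar_1)

lemma dchar_cong:
  assumes "dchar q chi" "[x = y] (mod q)"
  shows "chi x = chi y"
proof -
  have per: "chi (x + q) = chi x" for x using assms(1) by (simp add: dchar_def)
  have nat: "chi (x + int s * q) = chi x" for x s
  proof (induction s)
    case (Suc s)
    have "chi (x + int (Suc s) * q) = chi ((x + int s * q) + q)" by (simp add: algebra_simps)
    then show ?case using per Suc.IH by simp
  qed simp
  have "chi (x mod q) = chi x" for x
  proof (cases "x div q \<ge> 0")
    case True
    then show ?thesis using nat[of "x mod q" "nat (x div q)"] by simp
  next
    case False
    \<comment> \<open>\<open>nat\<close> only adds multiples of \<open>q\<close>, so for a negative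
      quotient it climbs from \<open>x\<close> to its residue.\<close>
    then show ?thesis using nat[of x "nat (- (x div q))"] by (simp add: minus_div_mult_eq_mod)
  qed
  then show ?thesis using assms(2) by (metis cong_def)
qed

lemma dchar_even:
  assumes "dchar (2 ^ m) chi" "m > 0" "even x"
  shows "chi x = 0"
proof -
  have "\<not> coprime x (2 ^ m)" using assms(2,3) by simp
  then show ?thesis using assms(1) by (simp add: dchar_def)
qed

lemma dchar_minus_1:
  assumes "dchar q chi"
  shows "chi (- 1) = 1 \<or> chi (- 1) = - 1"
proof -
  have "chi (- 1) ^ 2 = 1"
    using dchar_mult[OF assms, of "-1" "-1"] dchar_1[OF assms] by (simp add: power2_eq_square)
  then show ?thesis by (simp add: power2_eq_1_iff)
qed

lemma dchar_5_power:
  assumes "dchar (2 ^ m) chi" "chi 5 = eq (2 ^ (m - 2)) c" "2 \<le> i" "i \<le> m"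
  shows "chi (5 ^ (2 ^ (i - 2) * s)) = eq (2 ^ (m - i)) (c * int s)"
proof -
  have "chi (5 ^ (2 ^ (i - 2) * s)) = eq (2 ^ (m - 2)) (2 ^ (i - 2) * (c * int s))"
    using assms by (simp add: dchar_power eq_power algebra_simps)
  also have "\<dots> = eq (2 ^ (m - i)) (c * int s)"
  proof -
    have "m - 2 - (i - 2) = m - i" using assms(3,4) by simp
    then show ?thesis
      using assms(4) eq_power2_cancel[of "i - 2" "m - 2" "c * int s"] by (metis diff_le_mono)
  qed
  finally show ?thesis .
qed

text \<open>Since \<open>m <= 2 * i\<close>, the powers of
  \<open>1 + R i * 2 ^ i = 5 ^ (2 ^ (i - 2))\<close> are linear in the exponent modulo
  \<open>2 ^ m\<close>. Hence \<open>v + 2 ^ i * z\<close> is \<open>v\<close> times the power with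
  exponent \<open>z / (R i * v)\<close>. Any \<open>g\<close> representing this quotient may be
  supplied, so no inverse occurs in the statement.\<close>

lemma dchar_shift:
  assumes chi: "dchar (2 ^ m) chi" "chi 5 = eq (2 ^ (m - 2)) c"
    and i: "2 \<le> i" "i \<le> m" "m \<le> 2 * i"
    and g: "[g * R i * v = z] (mod 2 ^ (m - i))"
  shows "chi (v + 2 ^ i * z) = chi v * eq (2 ^ (m - i)) (c * g)"
proof -
  \<comment> \<open>\<open>g\<close> may be negative, while the exponent of 5 has to be a natural
    number.\<close>
  define s where "s = nat (g mod 2 ^ (m - i))"
  have s: "[int s = g] (mod 2 ^ (m - i))" by (simp add: s_def cong_def)
  have "[v * (1 + R i * 2 ^ i) ^ s = v * (1 + int s * (R i * 2 ^ i))] (mod (R i * 2 ^ i) ^ 2)"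
    by (intro cong_scalar_left one_plus_power_cong2)
  moreover have "2 ^ m dvd (R i * 2 ^ i) ^ 2"
    using i(3) by (simp add: power_mult_distrib power_mult[symmetric] le_imp_power_dvd dvd_mult mult.commute)
  ultimately have 1: "[v * (1 + R i * 2 ^ i) ^ s = v * (1 + int s * (R i * 2 ^ i))] (mod 2 ^ m)"
    using cong_dvd_modulus by blast
  have "[int s * R i * v = z] (mod 2 ^ (m - i))"
    using s g by (metis cong_scalar_right cong_trans)
  then have "[v + 2 ^ i * (int s * R i * v) = v + 2 ^ i * z] (mod 2 ^ m)"
    by (intro cong_add cong_refl cong_power2_mult[of _ _ "m - i"]) auto
  moreover have "v * (1 + int s * (R i * 2 ^ i)) = v + 2 ^ i * (int s * R i * v)"
    by (simp add: algebra_simps)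
  ultimately have 2: "[v + 2 ^ i * z = v * (1 + R i * 2 ^ i) ^ s] (mod 2 ^ m)"
    using 1 by (metis cong_sym cong_trans)
  have "chi (v + 2 ^ i * z) = chi v * chi (5 ^ (2 ^ (i - 2) * s))"
    using dchar_cong[OF chi(1) 2] R_expansion[OF i(1)]
    by (simp add: dchar_mult[OF chi(1)] power_mult)
  also have "\<dots> = chi v * eq (2 ^ (m - i)) (c * int s)"
    using dchar_5_power[OF chi i(1,2)] by simp
  also have "eq (2 ^ (m - i)) (c * int s) = eq (2 ^ (m - i)) (c * g)"
    by (intro eq_cong cong_scalar_left s) simp
  finally show ?thesis .
qed

text \<open>With \<open>c\<close> even, \<open>chi\<close> would be 1 on all residues congruent to 1
  modulo \<open>2 ^ (m - 1)\<close>, contradicting primitivity.\<close>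

lemma primitive_dchar_exponent_odd:
  assumes "m \<ge> 3" "primitive_dchar (2 ^ m) chi" "chi 5 = eq (2 ^ (m - 2)) c"
  shows "odd c"
proof
  assume "even c"
  have chi: "dchar (2 ^ m) chi" using assms(2) by (simp add: primitive_dchar_def)
  have "(2::int) ^ (m - 1) < 2 ^ m" "(2::int) ^ (m - 1) dvd 2 ^ m"
    using assms(1) by (auto simp: le_imp_power_dvd)
  then obtain x where x: "[x = 1] (mod 2 ^ (m - 1))" "chi x \<noteq> 1"
    using assms(2) unfolding primitive_dchar_def by (metis zero_less_numeral zero_less_power)
  then obtain y where y: "x = 1 + 2 ^ (m - 1) * y"
    by (metis add.commute cong_iff_lin cong_sym)
  \<comment> \<open>Only \<open>m - (m - 1) = 1\<close> bit matters, and modulo 2 the odd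
    \<open>R (m - 1)\<close> is its own inverse.\<close>
  have "chi x = chi 1 * eq (2 ^ (m - (m - 1))) (c * (y * R (m - 1)))"
    unfolding y
  proof (rule dchar_shift[OF chi assms(3)])
    have "odd (R (m - 1))" using assms(1) by (intro odd_R) simp
    then have "[y * R (m - 1) * R (m - 1) * 1 = y] (mod 2)"
      by (simp add: cong_def mod2_eq_if)
    then show "[y * R (m - 1) * R (m - 1) * 1 = y] (mod 2 ^ (m - (m - 1)))"
      using assms(1) by simp
  qed (use assms(1) in auto)
  also have "\<dots> = 1"
    using \<open>even c\<close> assms(1) by (simp add: dchar_1[OF chi] eq_eq_1_iff)
  finally show False using x(2) by simp
qed

subsection \<open>Residue classes generated by powers of 5\<close>

lemma cong_5_power_1:
  assumes "j \<ge> 2"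
  shows "[5 ^ (2 ^ (j - 2) * s) = (1::int)] (mod 2 ^ j)"
proof -
  have "[(5::int) ^ 2 ^ (j - 2) = 1] (mod 2 ^ j)"
    by (simp add: R_expansion[OF assms] cong_iff_dvd_diff)
  then show ?thesis
    using cong_pow[of "(5::int) ^ 2 ^ (j - 2)" 1 "2 ^ j" s] by (simp add: power_mult)
qed

text \<open>Write \<open>d = 2 ^ b * e\<close> with \<open>e\<close> odd. The power equals
  \<open>(1 + R i * 2 ^ i) ^ e\<close> with \<open>i = j + b < m\<close>, which differs from 1
  already modulo \<open>2 ^ (i + 1)\<close>.\<close>

lemma not_cong_5_power_1:
  assumes "j \<ge> 2" "0 < d" "d < 2 ^ (m - j)"
  shows "\<not> [5 ^ (2 ^ (j - 2) * d) = (1::int)] (mod 2 ^ m)"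
proof
  assume *: "[5 ^ (2 ^ (j - 2) * d) = (1::int)] (mod 2 ^ m)"
  obtain b e where d: "d = 2 ^ b * e" "odd e"
  proof (rule multiplicity_decompose'[of d 2])
    show "d \<noteq> 0" "\<not> is_unit (2::nat)" using assms(2) by auto
  qed
  have "2 ^ b \<le> d" using d by (cases e) auto
  then have "b < m - j"
    using assms(3) by (metis le_less_trans one_less_numeral_iff power_less_imp_less_exp semiring_norm(76))
  define i where "i = j + b"
  have i: "i \<ge> 2" "Suc i \<le> m" "i - 2 = (j - 2) + b" using \<open>b < m - j\<close> assms(1) by (auto simp: i_def)
  let ?x = "R i * 2 ^ i"
  have "(5::int) ^ (2 ^ (j - 2) * d) = (1 + ?x) ^ e"
    unfolding R_expansion[OF i(1), symmetric] i(3) d(1) by (simp add: power_add power_mult)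
  then have "[(1 + ?x) ^ e = 1] (mod 2 ^ Suc i)"
    using * i(2) by (metis cong_dvd_modulus le_imp_power_dvd)
  moreover have "[(1 + ?x) ^ e = 1 + int e * ?x] (mod 2 ^ Suc i)"
  proof (rule cong_dvd_modulus[OF one_plus_power_cong2])
    have "(2::int) ^ Suc i dvd 2 ^ (i * 2)" using i(1) by (intro le_imp_power_dvd) simp
    then show "2 ^ Suc i dvd ?x ^ 2" by (simp add: power_mult_distrib power_mult[symmetric])
  qed
  ultimately have "[1 + int e * ?x = 1] (mod 2 ^ Suc i)"
    by (metis cong_sym cong_trans)
  then have "2 ^ i * 2 dvd 2 ^ i * (int e * R i)"
    by (simp add: cong_iff_dvd_diff mult_ac)
  then have "even (int e * R i)" by (simp only: dvd_mult_cancel_left) simp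
  then show False using d(2) odd_R[OF i(1)] by simp
qed

lemma card_residue_class:
  fixes a :: int
  assumes "j \<le> m"
  shows "card {x \<in> {0..<2 ^ m}. [x = a] (mod 2 ^ j)} = 2 ^ (m - j)"
proof -
  let ?g = "\<lambda>q::int. a mod 2 ^ j + 2 ^ j * q"
  have m: "(2::int) ^ m = 2 ^ j * 2 ^ (m - j)" using assms by (simp add: power_add[symmetric])
  have "{x \<in> {0..<2 ^ m}. [x = a] (mod 2 ^ j)} = ?g ` {0..<2 ^ (m - j)}"
  proof (intro equalityI subsetI)
    fix x assume "x \<in> {x \<in> {0..<2 ^ m}. [x = a] (mod 2 ^ j)}"
    then have x: "0 \<le> x" "x < 2 ^ j * 2 ^ (m - j)" "x mod 2 ^ j = a mod 2 ^ j"
      by (auto simp: m cong_def)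
    have "x = ?g (x div 2 ^ j)"
      using x(3) by (metis mod_mult_div_eq)
    moreover have "x div 2 ^ j < 2 ^ (m - j)"
    proof -
      have "2 ^ j * (x div 2 ^ j) \<le> x"
        by (metis mult.commute div_mult_mod_eq le_add_same_cancel1 pos_mod_sign zero_less_numeral
            zero_less_power)
      then have "2 ^ j * (x div 2 ^ j) < 2 ^ j * 2 ^ (m - j)" using x(2) by linarith
      then show ?thesis by simp
    qed
    ultimately show "x \<in> ?g ` {0..<2 ^ (m - j)}"
      using x(1) by (intro image_eqI) (auto simp: pos_imp_zdiv_nonneg_iff)
  next
    fix x assume "x \<in> ?g ` {0..<2 ^ (m - j)}"
    then obtain q where q: "x = ?g q" "0 \<le> q" "q + 1 \<le> 2 ^ (m - j)" by auto
    have "0 \<le> a mod 2 ^ j" "a mod 2 ^ j < 2 ^ j" by auto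
    moreover have "2 ^ j * (q + 1) \<le> 2 ^ m" unfolding m using q(3) by (intro mult_left_mono) auto
    ultimately have "?g q < 2 ^ m" by (simp only: distrib_left)
    then show "x \<in> {x \<in> {0..<2 ^ m}. [x = a] (mod 2 ^ j)}"
      using q(2) unfolding q(1) by (auto simp: cong_def)
  qed
  moreover have "inj_on ?g {0..<2 ^ (m - j)}" by (auto simp: inj_on_def)
  ultimately show ?thesis by (simp add: card_image)
qed

text \<open>Injectivity is the order bound of \<open>not_cong_5_power_1\<close>; surjectivity
  follows by counting the class.\<close>

lemma bij_betw_5_power_residue_class:
  fixes a :: int
  assumes "2 \<le> j" "j \<le> m" "odd a"
  shows "bij_betw (\<lambda>s. a * 5 ^ (2 ^ (j - 2) * s) mod 2 ^ m) {..<2 ^ (m - j)}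
           {x \<in> {0..<2 ^ m}. [x = a] (mod 2 ^ j)}" (is "bij_betw ?g ?I ?X")
proof -
  have le: "s = s'" if "?g s = ?g s'" "s \<le> s'" "s' < 2 ^ (m - j)" for s s'
  proof (rule ccontr)
    assume "s \<noteq> s'"
    have "[(a * 5 ^ (2 ^ (j - 2) * s)) * 5 ^ (2 ^ (j - 2) * (s' - s))
        = (a * 5 ^ (2 ^ (j - 2) * s)) * 1] (mod 2 ^ m)"
      using that by (simp add: cong_def power_add[symmetric] algebra_simps)
    moreover have "coprime (a * 5 ^ (2 ^ (j - 2) * s)) (2 ^ m)" using assms(3) by simp
    ultimately have "[5 ^ (2 ^ (j - 2) * (s' - s)) = (1::int)] (mod 2 ^ m)"
      using cong_mult_lcancel by blast
    then show False
      using not_cong_5_power_1[OF assms(1), of "s' - s" m] that(2,3) \<open>s \<noteq> s'\<close> by simp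
  qed
  have inj: "inj_on ?g ?I"
  proof (rule inj_onI)
    fix s s' assume "s \<in> ?I" "s' \<in> ?I" "?g s = ?g s'"
    then show "s = s'" using le[of s s'] le[of s' s] by (cases "s \<le> s'") auto
  qed
  have sub: "?g ` ?I \<subseteq> ?X"
  proof
    fix x assume "x \<in> ?g ` ?I"
    then obtain s where x: "x = ?g s" by blast
    have "[x = a * 5 ^ (2 ^ (j - 2) * s)] (mod 2 ^ j)"
      unfolding x using assms(2) by (metis cong_def cong_dvd_modulus le_imp_power_dvd mod_mod_trivial)
    also have "[a * 5 ^ (2 ^ (j - 2) * s) = a * 1] (mod 2 ^ j)"
      by (intro cong_scalar_left cong_5_power_1 assms)
    finally show "x \<in> ?X" by (simp add: x)
  qed
  have "finite ?X" by (rule finite_subset[of _ "{0..<2 ^ m}"]) auto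
  then have "?g ` ?I = ?X"
    using sub card_residue_class[OF assms(2), of a]
    by (intro card_subset_eq) (simp_all add: card_image[OF inj])
  then show ?thesis using inj by (simp add: bij_betw_def)
qed

lemma eq_2_odd:
  assumes "odd c"
  shows "eq 2 c = - 1"
proof -
  have "eq 2 c ^ 2 = 1" by (simp add: eq_power eq_eq_1_iff)
  moreover have "eq 2 c \<noteq> 1" using assms by (simp add: eq_eq_1_iff)
  ultimately show ?thesis by (simp add: power2_eq_1_iff)
qed

text \<open>The case \<open>j = 2\<close> of the parametrization writes every odd residue as plus or
  minus a power of 5, so only the value at -1 is left.\<close>

lemma dchar_trivial_at_5:
  assumes "dchar (2 ^ m) chi" "m \<ge> 2" "chi 5 = 1"
  shows "chi (- 1) = 1 \<Longrightarrow> chi = chi0_2" and "chi (- 1) = - 1 \<Longrightarrow> chi = chi4"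
proof -
  have a: "chi x = chi a" if xa: "[x = a] (mod 4)" "odd a" for x a
  proof -
    have "[x mod 2 ^ m = a] (mod 2 ^ 2)"
    proof -
      have "(4::int) dvd 2 ^ m" using le_imp_power_dvd[OF assms(2), of "2::int"] by simp
      then show ?thesis using xa(1) by (simp add: cong_def mod_mod_cancel)
    qed
    then have "x mod 2 ^ m \<in> (\<lambda>s. a * 5 ^ (2 ^ (2 - 2) * s) mod 2 ^ m) ` {..<2 ^ (m - 2)}"
      using bij_betw_imp_surj_on[OF bij_betw_5_power_residue_class[OF order.refl assms(2) xa(2)]]
      by simp
    then obtain s where "[x = a * 5 ^ s] (mod 2 ^ m)" by (auto simp: cong_def)
    from dchar_cong[OF assms(1) this] show ?thesis
      using assms(3) by (simp add: dchar_mult[OF assms(1)] dchar_power[OF assms(1)])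
  qed
  have 1: "chi x = 1" if "x mod 4 = 1" for x
    using a[of x 1] that dchar_1[OF assms(1)] by (simp add: cong_def)
  have 3: "chi x = chi (- 1)" if "x mod 4 = 3" for x
    using a[of x "-1"] that by (simp add: cong_def)
  have odd: "x mod 4 = 1 \<or> x mod 4 = 3" if "odd x" for x :: int
    using that by presburger
  have 0: "chi x = 0" if "even x" for x
    using dchar_even[OF assms(1)] that assms(2) by simp
  show "chi = chi0_2" if "chi (- 1) = 1"
  proof
    fix x show "chi x = chi0_2 x"
    proof (cases "odd x")
      case True
      then show ?thesis using odd[of x] 1[of x] 3[of x] that unfolding chi0_2_def by auto
    qed (simp add: 0 chi0_2_def)
  qed
  show "chi = chi4" if "chi (- 1) = - 1"
  proof
    fix x show "chi x = chi4 x"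
    proof (cases "odd x")
      case True
      then show ?thesis using odd[of x] 1[of x] 3[of x] that unfolding chi4_def by auto
    qed (simp add: 0 chi4_def)
  qed
qed

subsection \<open>Roots of unity modulo powers of two\<close>

lemma odd_sum_powers_iff: "odd y \<Longrightarrow> odd (\<Sum>i<s. y ^ i) \<longleftrightarrow> odd s" for y :: int
  by (induction s) auto

text \<open>The cofactor of \<open>y - 1\<close> in \<open>y ^ s - 1\<close> is a sum of an odd
  number of odd terms, hence a unit modulo \<open>2 ^ F\<close>.\<close>

lemma odd_power_root_1:
  fixes y :: int
  assumes "odd s" "odd y" "[y ^ s = 1] (mod 2 ^ F)"
  shows "[y = 1] (mod 2 ^ F)"
proof -
  have "2 ^ F dvd (y - 1) * (\<Sum>i<s. y ^ i)"
    using assms(3) by (simp add: cong_iff_dvd_diff power_diff_1_eq)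
  moreover have "coprime (2 ^ F) (\<Sum>i<s. y ^ i)"
    using odd_sum_powers_iff[OF assms(2), of s] assms(1) by simp
  ultimately show ?thesis
    by (simp add: coprime_dvd_mult_left_iff cong_iff_dvd_diff)
qed

text \<open>For \<open>z\<close> congruent to 1 modulo 4, \<open>z + 1\<close> is exactly divisible
  by 2, so one bit of precision is lost.\<close>

lemma square_root_1:
  fixes z :: int
  assumes "[z = 1] (mod 4)" "[z ^ 2 = 1] (mod 2 ^ Suc G)"
  shows "[z = 1] (mod 2 ^ G)"
proof -
  obtain w where w: "z = 1 + 4 * w" using assms(1) by (metis cong_iff_lin cong_sym mult.commute)
  have "2 * 2 ^ G dvd 2 * ((z - 1) * (1 + 2 * w))"
    using assms(2) by (simp add: w cong_iff_dvd_diff power2_eq_square algebra_simps)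
  then have "2 ^ G dvd (z - 1) * (1 + 2 * w)" by (simp only: dvd_mult_cancel_left) simp
  moreover have "coprime (2 ^ G) (1 + 2 * w)" by simp
  ultimately show ?thesis by (simp add: coprime_dvd_mult_left_iff cong_iff_dvd_diff)
qed

lemma power2_power_root_1:
  fixes y :: int
  assumes "[y = 1] (mod 4)" "[y ^ (2 ^ t) = 1] (mod 2 ^ F)" "t \<le> F"
  shows "[y = 1] (mod 2 ^ (F - t))"
  using assms(2,3)
proof (induction t arbitrary: F)
  case (Suc t)
  have "[y ^ (2 ^ t) = 1] (mod 4)" using cong_pow[OF assms(1), of "2 ^ t"] by simp
  moreover have "[(y ^ (2 ^ t)) ^ 2 = 1] (mod 2 ^ Suc (F - 1))"
    using Suc.prems by (simp add: power_mult[symmetric] mult.commute)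
  ultimately have "[y ^ (2 ^ t) = 1] (mod 2 ^ (F - 1))" by (rule square_root_1)
  then show ?case using Suc.IH[of "F - 1"] Suc.prems by simp
qed simp

text \<open>The quotient \<open>z\<close> of \<open>x\<close> by \<open>y\<close> is a root of unity
  modulo \<open>2 ^ F\<close>. The odd part of the exponent can be removed without loss; each of the
  \<open>t\<close> square roots costs one bit, once the sign is chosen so that the root is 1 modulo
  4.\<close>

lemma equal_powers_cong:
  fixes x y :: int
  assumes "odd x" "odd y" "odd s" "[x ^ (2 ^ t * s) = y ^ (2 ^ t * s)] (mod 2 ^ F)" "t \<le> F"
  shows "[x = y] (mod 2 ^ (F - t)) \<or> t > 0 \<and> [x = - y] (mod 2 ^ (F - t))"
proof -
  obtain y' where y': "[y * y' = 1] (mod 2 ^ F)"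
    using assms(2) cong_solve_coprime_int[of y "2 ^ F"] by auto
  \<comment> \<open>For \<open>F = 0\<close> the inverse \<open>y'\<close> is arbitrary and may be
    even; the value 1 keeps \<open>z\<close> odd.\<close>
  define z where "z = (if F = 0 then 1 else x * y')"
  have "odd y'" if "F > 0"
  proof
    assume "even y'"
    moreover have "[y * y' = 1] (mod 2)" using y' that by (meson cong_dvd_modulus dvd_power)
    ultimately show False by (simp add: cong_def mod2_eq_if)
  qed
  then have "odd z" using assms(1) by (simp add: z_def)
  have "[(x * y') ^ (2 ^ t * s) = (y * y') ^ (2 ^ t * s)] (mod 2 ^ F)"
    using assms(4) by (simp add: power_mult_distrib cong_scalar_right)
  also have "[(y * y') ^ (2 ^ t * s) = 1] (mod 2 ^ F)" using cong_pow[OF y'] by simp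
  finally have "[(z ^ (2 ^ t)) ^ s = 1] (mod 2 ^ F)"
    by (auto simp: z_def power_mult)
  then have z: "[z ^ (2 ^ t) = 1] (mod 2 ^ F)"
    using odd_power_root_1[OF assms(3)] \<open>odd z\<close> by simp
  have yz: "[y * z = x] (mod 2 ^ F)"
  proof -
    have "[x * (y * y') = x * 1] (mod 2 ^ F)" by (intro cong_scalar_left y')
    then show ?thesis by (auto simp: z_def mult_ac)
  qed
  then have yz: "[y * z = x] (mod 2 ^ (F - t))"
    by (meson cong_dvd_modulus diff_le_self le_imp_power_dvd)
  have "z mod 4 = 1 \<or> z mod 4 = 3" using \<open>odd z\<close> by presburger
  then consider "t = 0" | "t > 0" "[z = 1] (mod 4)" | "t > 0" "[z = -1] (mod 4)"
    by (auto simp: cong_def)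
  then show ?thesis
  proof cases
    case 1
    then have "[y * z = y * 1] (mod 2 ^ F)" using z by (intro cong_scalar_left) simp
    then show ?thesis using yz 1 by (auto simp: cong_def)
  next
    case 2
    then have "[y * z = y * 1] (mod 2 ^ (F - t))"
      using power2_power_root_1[OF _ z assms(5)] by (intro cong_scalar_left)
    then show ?thesis using yz by (auto simp: cong_def)
  next
    case 3
    then have "[- z = 1] (mod 4)" using cong_minus_minus_iff[of z "-1" 4] by simp
    moreover have "[(- z) ^ (2 ^ t) = 1] (mod 2 ^ F)" using z 3(1) by simp
    ultimately have "[- z = 1] (mod 2 ^ (F - t))" using power2_power_root_1 assms(5) by blast
    then have "[- y * - z = - y * 1] (mod 2 ^ (F - t))" by (rule cong_scalar_left)
    then show ?thesis using yz 3(1) by (auto simp: cong_def)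
  qed
qed

lemma odd_not_cong_minus:
  fixes a b :: int
  assumes "odd a" "[a = b] (mod 4)" "j \<ge> 2"
  shows "a mod 2 ^ j \<noteq> - b mod 2 ^ j"
proof
  assume "a mod 2 ^ j = - b mod 2 ^ j"
  then have "[a = - b] (mod 2 ^ j)" by (simp add: cong_def)
  then have "[a = - b] (mod 4)"
    using le_imp_power_dvd[OF assms(3), of "2::int"] by (simp add: cong_dvd_modulus)
  then have "[a + a = b + - b] (mod 4)" by (rule cong_add[OF assms(2)])
  then have "2 * 2 dvd 2 * a" by (simp add: cong_0_iff)
  then show False using assms(1) by (simp only: dvd_mult_cancel_left) simp
qed

subsection \<open>The Jacobi symbol of 2\<close>

text \<open>On odd arguments this is the quadratic character attached to 2, by the second
  supplementary law.\<close>

definition sign_mod_8 :: "nat \<Rightarrow> int" where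
  "sign_mod_8 x = (if x mod 8 \<in> {1, 7} then 1 else - 1)"

lemma sign_mod_8_mult:
  assumes "odd x" "odd y"
  shows "sign_mod_8 (x * y) = sign_mod_8 x * sign_mod_8 y"
proof -
  have "x mod 8 \<in> {1, 3, 5, 7}" "y mod 8 \<in> {1, 3, 5, 7}"
    using assms by (simp_all, presburger+)
  then show ?thesis
    unfolding sign_mod_8_def by (subst mod_mult_eq[symmetric]) (elim insertE emptyE, simp_all)
qed

lemma sign_mod_8_power: "odd x \<Longrightarrow> sign_mod_8 (x ^ s) = sign_mod_8 x ^ s"
proof (induction s)
  case 0
  show ?case by (simp add: sign_mod_8_def)
next
  case (Suc s)
  then show ?case by (simp add: sign_mod_8_mult)
qed

lemma sign_mod_8_prod:
  "finite P \<Longrightarrow> (\<And>p. p \<in> P \<Longrightarrow> odd (f p)) \<Longrightarrow> sign_mod_8 (\<Prod>p\<in>P. f p) = (\<Prod>p\<in>P. sign_mod_8 (f p))"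
proof (induction P rule: finite_induct)
  case empty
  show ?case by (simp add: sign_mod_8_def)
next
  case (insert p P)
  then have "odd (\<Prod>p\<in>P. f p)" by (auto simp: even_prod_iff)
  then show ?case using insert by (simp add: sign_mod_8_mult)
qed

text \<open>Gauss's lemma with multiplier 2: the multiples \<open>2, 4, ..., 2 * h\<close> are
  already reduced modulo \<open>p = 2 * h + 1\<close>, and those above \<open>h\<close> come from
  \<open>x > h div 2\<close>.\<close>

lemma Legendre_2:
  assumes "prime p" "p > 2"
  shows "Legendre 2 (int p) = sign_mod_8 p"
proof -
  have "\<not> p dvd 2" using assms(2) by (auto dest: dvd_imp_le)
  then have "\<not> int p dvd 2" by (metis of_nat_dvd_iff of_nat_numeral)
  then interpret GAUSS p 2
    using assms by unfold_locales (auto simp: cong_0_iff)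
  define h where "h = (int p - 1) div 2"
  have p: "int p = 2 * h + 1" using p_eq2 by (simp add: h_def)
  have C: "C = (\<lambda>x. 2 * x) ` {0<..h}"
    unfolding C_def B_def A_def image_image h_def[symmetric]
    by (intro image_cong) (auto simp: p mult.commute)
  have "E = (\<lambda>x. 2 * x) ` {h div 2<..h}"
    unfolding E_def C h_def[symmetric] using p assms(2) by (auto simp: image_iff)
  then have "card E = nat (h - h div 2)"
    by (simp add: card_image inj_on_def)
  moreover have "even (nat (h - h div 2)) \<longleftrightarrow> p mod 8 \<in> {1, 7}"
  proof -
    have "h \<ge> 0" using p by linarith
    then have "even (nat (h - h div 2)) \<longleftrightarrow> even (h - h div 2)" by (simp add: even_nat_iff)
    also have "\<dots> \<longleftrightarrow> ((2 * h + 1) mod 8 = 1 \<or> (2 * h + 1) mod 8 = 7)" by presburger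
    also have "(2 * h + 1) mod 8 = int (p mod 8)" unfolding p[symmetric] by (simp add: zmod_int)
    also have "(int (p mod 8) = 1 \<or> int (p mod 8) = 7) \<longleftrightarrow> p mod 8 \<in> {1, 7}" by auto
    finally show ?thesis .
  qed
  ultimately show ?thesis using gauss_lemma by (auto simp: sign_mod_8_def)
qed

lemma jacobi_2:
  assumes "odd h"
  shows "jacobi 2 h = (if h mod 8 \<in> {1, 7} then 1 else - 1)"
proof -
  define b where "b = nat \<bar>h\<bar>"
  have b: "odd b" "b > 0" using assms by (auto simp: b_def even_nat_iff)
  have p: "prime p \<and> p > 2 \<and> odd p" if "p \<in> prime_factors b" for p
  proof -
    have "prime p" "p dvd b" using that by auto
    then have "odd p" using b(1) by (meson dvd_trans)
    then show ?thesis using \<open>prime p\<close> prime_ge_2_nat[of p] by (cases "p = 2") auto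
  qed
  have "jacobi 2 h = (\<Prod>p\<in>prime_factors b. sign_mod_8 (p ^ multiplicity p b))"
    unfolding jacobi_def b_def[symmetric]
    by (intro prod.cong refl) (simp add: p Legendre_2 sign_mod_8_power)
  also have "\<dots> = sign_mod_8 (\<Prod>p\<in>prime_factors b. p ^ multiplicity p b)"
    using p by (subst sign_mod_8_prod) auto
  also have "\<dots> = sign_mod_8 b" using prime_factorization_nat[OF b(2)] by simp
  \<comment> \<open>Negation exchanges 1 and 7 modulo 8, so passing to the absolute value is
    harmless.\<close>
  also have "b mod 8 \<in> {1, 7} \<longleftrightarrow> h mod 8 \<in> {1, 7}"
  proof -
    have "int (b mod 8) = \<bar>h\<bar> mod 8" by (simp add: b_def zmod_int)
    then have "b mod 8 \<in> {1, 7} \<longleftrightarrow> \<bar>h\<bar> mod 8 = 1 \<or> \<bar>h\<bar> mod 8 = 7" by auto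
    also have "\<dots> \<longleftrightarrow> h mod 8 = 1 \<or> h mod 8 = 7" by (cases "h \<ge> 0") (simp_all, presburger)
    finally show ?thesis by simp
  qed
  then have "sign_mod_8 b = (if h mod 8 \<in> {1, 7} then 1 else - 1)"
    unfolding sign_mod_8_def by simp
  finally show ?thesis .
qed

text \<open>Both sides depend only on \<open>h\<close> modulo 8, which leaves four cases, all
  derived from \<open>sqrt 2 * w = 1 + \<i>\<close> and \<open>w * w = \<i>\<close>.\<close>

lemma sqrt2_omega_jacobi:
  assumes "odd h"
  shows "complex_of_real (sqrt 2) * (exp (\<i> * of_real pi / 4) powi h * of_int (jacobi 2 h)) = 1 + eq 4 h"
proof -
  define w where "w = exp (\<i> * of_real pi / 4)"
  have "w = cis (pi / 4)" by (simp add: w_def cis_conv_exp)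
  then have w: "complex_of_real (sqrt 2) * w = 1 + \<i>"
    by (simp only:) (simp add: complex_eq_iff cos_45 sin_45)
  have "w * w = exp (\<i> * of_real pi / 4 + \<i> * of_real pi / 4)" by (simp only: w_def exp_add)
  also have "\<i> * of_real pi / 4 + \<i> * of_real pi / 4 = \<i> * complex_of_real (pi / 2)" by simp
  also have "exp \<dots> = \<i>" by (simp only: cis_conv_exp[symmetric] cis_pi_half)
  finally have w2: "w * w = \<i>" .
  have [simp]: "w \<noteq> 0" by (simp add: w_def)
  have w8: "w ^ 8 = 1"
  proof -
    have "w ^ 8 = ((w * w) * (w * w)) * ((w * w) * (w * w))" by (simp add: eval_nat_numeral mult_ac)
    then show ?thesis by (simp add: w2)
  qed
  define q r where "q = h div 8" and "r = h mod 8"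
  have h: "h = 8 * q + r" by (simp add: q_def r_def)
  have r: "r \<in> {1, 3, 5, 7}" using assms unfolding r_def by (simp, presburger)
  have "w powi h = (w powi 8) powi q * w powi r"
    by (simp add: h power_int_add power_int_mult)
  also have "w powi 8 = 1" using w8 by simp
  finally have wh: "w powi h = w powi r" by simp
  have "eq 4 1 = exp (\<i> * complex_of_real (pi / 2))" by (simp add: eq_def mult.commute)
  also have "\<dots> = \<i>" by (simp only: cis_conv_exp[symmetric] cis_pi_half)
  finally have "eq 4 1 = \<i>" .
  moreover have "eq 4 h = eq 4 1 ^ nat r"
  proof -
    have "h - int (nat r) = 4 * (2 * q)" using r by (auto simp: h)
    then have "[h = int (nat r) * 1] (mod 4)" by (simp only: cong_iff_dvd_diff mult_1_right) simp
    then show ?thesis unfolding eq_power by (intro eq_cong) auto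
  qed
  ultimately have eqh: "eq 4 h = \<i> ^ nat r" by simp
  have jac: "jacobi 2 h = (if r \<in> {1, 7} then 1 else - 1)"
    using jacobi_2[OF assms] by (simp add: r_def)
  have "complex_of_real (sqrt 2) * (w powi r * of_int (if r \<in> {1, 7} then 1 else - 1)) = 1 + \<i> ^ nat r"
  proof -
    have "w powi 3 = \<i> * w" "w powi 5 = - w" "w powi 7 = - (\<i> * w)"
    proof -
      have "w ^ 3 = (w * w) * w" "w ^ 5 = (w * w) * (w * w) * w" "w ^ 7 = (w * w) * (w * w) * (w * w) * w"
        by (simp_all add: eval_nat_numeral mult_ac)
      then show "w powi 3 = \<i> * w" "w powi 5 = - w" "w powi 7 = - (\<i> * w)"
        by (simp_all add: w2)
    qed
    moreover have "complex_of_real (sqrt 2) * (w * \<i>) = \<i> - 1"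
      by (simp only: mult.assoc[symmetric] w) (simp add: distrib_right)
    ultimately show ?thesis
      using r by (elim insertE emptyE) (simp_all add: w eval_nat_numeral)
  qed
  then show ?thesis unfolding w_def[symmetric] wh eqh jac .
qed

subsection \<open>Sums over residue classes\<close>

text \<open>
  The bounds on \<open>N\<close> are all that is used of its definition, which lets the class sums be evaluated in
  all four cases at once.
\<close>
locale two_power_sum =
  fixes m n t k k1 N :: nat and A A1 B c1 c2 Rinv :: int and chi1 chi2 :: "int \<Rightarrow> complex"
  assumes chi1: "dchar (2 ^ m) chi1" and chi1_5: "chi1 5 = eq (2 ^ (m - 2)) c1"
    and chi2: "dchar (2 ^ m) chi2" and chi2_5: "chi2 5 = eq (2 ^ (m - 2)) c2"
    and A_eq: "A = 2 ^ n * A1" and k_eq: "k = 2 ^ t * k1" and n_pos: "n > 0"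
    and odd_A1: "odd A1" and odd_k1: "odd k1" and odd_B: "odd B" and odd_c2: "odd c2"
    and N_ge: "t + 2 \<le> N" and N_le: "N + n \<le> m" and m_le: "m \<le> 2 * N + n"
    and Rinv: "[R (N + n) * Rinv = 1] (mod 2 ^ m)"
begin

definition f :: "int \<Rightarrow> complex" where
  "f x = chi1 x * chi2 (A * x ^ k + B)"

definition C :: "int \<Rightarrow> int" where
  "C x = c1 * (A * x ^ k + B) + c2 * A * int k * x ^ k * R N * Rinv"

definition class_sum :: "nat \<Rightarrow> int \<Rightarrow> complex" where
  "class_sum j a = (\<Sum>x\<in>{x \<in> {0..<2 ^ m}. [x = a] (mod 2 ^ j)}. f x)"

definition S :: complex where
  "S = (\<Sum>x\<in>{1..2 ^ m}. f x)"

lemma m_ge_3: "m \<ge> 3"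
  using n_pos N_ge N_le by simp

lemma even_A: "even A"
  using n_pos by (simp add: A_eq)

lemma odd_argument: "odd (A * x ^ k + B)"
  using even_A odd_B by simp

lemma odd_Rinv: "odd Rinv"
proof
  assume "even Rinv"
  moreover have "[R (N + n) * Rinv = 1] (mod 2)"
    using Rinv m_ge_3 by (meson cong_dvd_modulus dvd_power less_le_trans zero_less_numeral)
  ultimately show False by (simp add: cong_def mod2_eq_if)
qed

lemma f_cong:
  assumes "[x = y] (mod 2 ^ m)"
  shows "f x = f y"
proof -
  have "[A * x ^ k + B = A * y ^ k + B] (mod 2 ^ m)"
    using assms by (intro cong_add cong_scalar_left cong_pow cong_refl)
  then show ?thesis
    using assms unfolding f_def by (metis dchar_cong[OF chi1] dchar_cong[OF chi2])
qed

lemma f_even: "even x \<Longrightarrow> f x = 0"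
  using dchar_even[OF chi1] m_ge_3 by (simp add: f_def)

lemma f_minus:
  assumes "even k"
  shows "f (- x) = chi1 (- 1) * f x"
  using dchar_mult[OF chi1, of "-1" x] assms by (simp add: f_def)

lemma C_minus: "even k \<Longrightarrow> C (- x) = C x"
  by (simp add: C_def)

lemma C_eq: "C x = c1 * (A * x ^ k + B) + 2 ^ (n + t) * (c2 * A1 * int k1 * x ^ k * R N * Rinv)"
  unfolding C_def by (simp add: A_eq k_eq power_add)

lemma argument_inverse: obtains D where "[(A * x ^ k + B) * D = 1] (mod 2 ^ m)"
  using odd_argument[of x] cong_solve_coprime_int[of "A * x ^ k + B" "2 ^ m"] by auto

text \<open>\<open>K\<close> is \<open>C a\<close> divided by the unit \<open>A * a ^ k + B\<close>,
  so a power of 2 up to \<open>2 ^ m\<close> divides one exactly when it divides the other.\<close>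

lemma f_mult_5_power:
  assumes "odd a"
  obtains K where "[(A * a ^ k + B) * K = C a] (mod 2 ^ m)"
    "\<And>s. f (a * 5 ^ (2 ^ (N - t - 2) * s)) = f a * eq (2 ^ (m - (N - t))) (int s * K)"
proof -
  define j where "j = N - t"
  define v where "v = A * a ^ k + B"
  obtain D where D: "[v * D = 1] (mod 2 ^ m)" unfolding v_def by (rule argument_inverse)
  \<comment> \<open>This is \<open>A1 * a ^ k * k1 * R N\<close> divided by
    \<open>R (N + n) * v\<close>, the quotient that \<open>dchar_shift\<close> asks for at level
    \<open>N + n\<close> when \<open>s = 1\<close>.\<close>
  define g where "g = Rinv * D * A1 * a ^ k * int k1 * R N"
  have j: "2 \<le> j" "j \<le> m" "n + t \<le> m - j" "m - j - (n + t) = m - (N + n)"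
    using N_ge N_le by (auto simp: j_def)
  have "f (a * 5 ^ (2 ^ (j - 2) * s))
      = f a * eq (2 ^ (m - j)) (int s * (c1 + 2 ^ (n + t) * (c2 * g)))" for s
  proof -
    let ?x = "R N * 2 ^ N" and ?e = "k1 * s"
    have "2 ^ (j - 2) * s * k = 2 ^ (N - 2) * ?e"
    proof -
      have "N - 2 = (j - 2) + t" using j(1) by (simp add: j_def)
      then show ?thesis by (simp add: k_eq power_add)
    qed
    then have "(a * 5 ^ (2 ^ (j - 2) * s)) ^ k = a ^ k * (1 + ?x) ^ ?e"
      unfolding R_expansion[of N, symmetric, OF order.trans[OF le_add2 N_ge]]
      by (simp add: power_mult_distrib power_mult[symmetric])
    then have pow: "A * (a * 5 ^ (2 ^ (j - 2) * s)) ^ k + B = A1 * a ^ k * (2 ^ n * (1 + ?x) ^ ?e) + B"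
      by (simp add: A_eq)
    have "[(1 + ?x) ^ ?e = 1 + int ?e * ?x] (mod 2 ^ (2 * N))"
    proof (rule cong_dvd_modulus[OF one_plus_power_cong2])
      show "2 ^ (2 * N) dvd ?x ^ 2"
        by (simp add: power_mult_distrib power_mult[symmetric] mult.commute)
    qed
    \<comment> \<open>The factor \<open>2 ^ n\<close> of \<open>A\<close> raises the precision
      \<open>2 * N\<close> to \<open>2 * N + n\<close>, which is at least \<open>m\<close>.\<close>
    then have "[A1 * a ^ k * (2 ^ n * (1 + ?x) ^ ?e) + B
        = A1 * a ^ k * (2 ^ n * (1 + int ?e * ?x)) + B] (mod 2 ^ m)"
      using m_le by (intro cong_add cong_refl cong_scalar_left cong_power2_mult[of _ _ "2 * N"]) auto
    also have "A1 * a ^ k * (2 ^ n * (1 + int ?e * ?x)) + B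
        = v + 2 ^ (N + n) * (A1 * a ^ k * (int ?e * R N))"
      by (simp add: v_def A_eq power_add algebra_simps)
    finally have "chi2 (A * (a * 5 ^ (2 ^ (j - 2) * s)) ^ k + B)
        = chi2 (v + 2 ^ (N + n) * (A1 * a ^ k * (int ?e * R N)))"
      unfolding pow by (rule dchar_cong[OF chi2])
    also have "\<dots> = chi2 v * eq (2 ^ (m - (N + n))) (c2 * (int s * g))"
    proof (rule dchar_shift[OF chi2 chi2_5])
      have "[(R (N + n) * Rinv) * (v * D) * (A1 * a ^ k * (int ?e * R N))
          = 1 * 1 * (A1 * a ^ k * (int ?e * R N))] (mod 2 ^ m)"
        by (intro cong_mult D Rinv cong_refl)
      then have "[int s * g * R (N + n) * v = A1 * a ^ k * (int ?e * R N)] (mod 2 ^ m)"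
        by (simp add: g_def mult_ac)
      then show "[int s * g * R (N + n) * v = A1 * a ^ k * (int ?e * R N)] (mod 2 ^ (m - (N + n)))"
        by (meson cong_dvd_modulus diff_le_self le_imp_power_dvd)
    qed (use N_ge N_le m_le in auto)
    \<comment> \<open>Both characters are brought to the modulus \<open>2 ^ (m - j)\<close>, so that
      their exponents can be added.\<close>
    also have "eq (2 ^ (m - (N + n))) (c2 * (int s * g))
        = eq (2 ^ (m - j)) (2 ^ (n + t) * (c2 * (int s * g)))"
      using eq_power2_cancel[OF j(3), of "c2 * (int s * g)"] by (simp only: j(4))
    finally have "f (a * 5 ^ (2 ^ (j - 2) * s)) =
        f a * (eq (2 ^ (m - j)) (c1 * int s) * eq (2 ^ (m - j)) (2 ^ (n + t) * (c2 * (int s * g))))"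
      using dchar_5_power[OF chi1 chi1_5 j(1,2), of s]
      by (simp add: f_def v_def dchar_mult[OF chi1])
    also have "eq (2 ^ (m - j)) (c1 * int s) * eq (2 ^ (m - j)) (2 ^ (n + t) * (c2 * (int s * g)))
        = eq (2 ^ (m - j)) (int s * (c1 + 2 ^ (n + t) * (c2 * g)))"
      by (simp add: eq_add[symmetric] algebra_simps)
    finally show ?thesis .
  qed
  moreover have "[v * (c1 + 2 ^ (n + t) * (c2 * g)) = C a] (mod 2 ^ m)"
  proof -
    have "[c1 * v + (v * D) * (2 ^ (n + t) * (c2 * A1 * int k1 * a ^ k * R N * Rinv))
        = c1 * v + 1 * (2 ^ (n + t) * (c2 * A1 * int k1 * a ^ k * R N * Rinv))] (mod 2 ^ m)"
      by (intro cong_add cong_mult D cong_refl)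
    then show ?thesis unfolding C_eq v_def[symmetric] g_def by (simp add: algebra_simps)
  qed
  ultimately show ?thesis using that unfolding v_def j_def by blast
qed

text \<open>Parametrizing the class by powers of 5 turns the sum into a geometric one with exponent
  \<open>K\<close>, and \<open>K\<close> may be replaced by \<open>C a\<close> in the divisibility
  test.\<close>

lemma class_sum_eq:
  assumes "odd a"
  shows "class_sum (N - t) a = (if 2 ^ (m - (N - t)) dvd C a then 2 ^ (m - (N - t)) * f a else 0)"
proof -
  define j where "j = N - t"
  have j: "2 \<le> j" "j \<le> m" using N_ge N_le by (auto simp: j_def)
  obtain K where K: "[(A * a ^ k + B) * K = C a] (mod 2 ^ m)"
    and f: "\<And>s. f (a * 5 ^ (2 ^ (j - 2) * s)) = f a * eq (2 ^ (m - j)) (int s * K)"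
    using f_mult_5_power[OF assms] unfolding j_def by metis
  have "class_sum j a = (\<Sum>s<2 ^ (m - j). f (a * 5 ^ (2 ^ (j - 2) * s) mod 2 ^ m))"
    unfolding class_sum_def
    by (rule sum.reindex_bij_betw[OF bij_betw_5_power_residue_class[OF j assms], symmetric])
  also have "\<dots> = (\<Sum>s<2 ^ (m - j). f a * eq (2 ^ (m - j)) (int s * K))"
  proof (intro sum.cong refl)
    fix s
    have "[a * 5 ^ (2 ^ (j - 2) * s) mod 2 ^ m = a * 5 ^ (2 ^ (j - 2) * s)] (mod 2 ^ m)"
      by (simp add: cong_def)
    from f_cong[OF this] show "f (a * 5 ^ (2 ^ (j - 2) * s) mod 2 ^ m) = f a * eq (2 ^ (m - j)) (int s * K)"
      by (simp only: f)
  qed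
  also have "\<dots> = f a * (if 2 ^ (m - j) dvd K then 2 ^ (m - j) else 0)"
    using sum_eq_multiples[of "2 ^ (m - j)" K] by (simp add: sum_distrib_left[symmetric])
  also have "2 ^ (m - j) dvd K \<longleftrightarrow> 2 ^ (m - j) dvd C a"
  proof -
    have "[(A * a ^ k + B) * K = C a] (mod 2 ^ (m - j))"
      using K by (meson cong_dvd_modulus diff_le_self le_imp_power_dvd)
    then have "2 ^ (m - j) dvd C a \<longleftrightarrow> 2 ^ (m - j) dvd (A * a ^ k + B) * K"
      by (simp add: cong_dvd_iff)
    also have "\<dots> \<longleftrightarrow> 2 ^ (m - j) dvd K"
      using odd_argument[of a] by (simp add: coprime_dvd_mult_right_iff)
    finally show ?thesis by simp
  qed
  finally show ?thesis by (simp add: j_def)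
qed

lemma class_sum_cong: "[a = b] (mod 2 ^ j) \<Longrightarrow> class_sum j a = class_sum j b"
  by (simp add: class_sum_def cong_def)

lemma S_odd: "S = (\<Sum>x\<in>{x \<in> {0..<2 ^ m}. odd x}. f x)"
  unfolding S_def
proof (rule sum.mono_neutral_right)
  show "{x \<in> {0..<2 ^ m}. odd x} \<subseteq> {1..2 ^ m :: int}"
  proof
    fix x :: int assume "x \<in> {x \<in> {0..<2 ^ m}. odd x}"
    then have "0 \<le> x" "x < 2 ^ m" "odd x" by auto
    then show "x \<in> {1..2 ^ m}" by (cases "x = 0") auto
  qed
  show "\<forall>x\<in>{1..2 ^ m} - {x \<in> {0..<2 ^ m}. odd x}. f x = 0"
  proof
    fix x :: int assume x: "x \<in> {1..2 ^ m} - {x \<in> {0..<2 ^ m}. odd x}"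
    have "even ((2::int) ^ m)" using m_ge_3 by simp
    with x have "even x" by (cases "x = 2 ^ m") auto
    then show "f x = 0" by (rule f_even)
  qed
qed simp

lemma S_eq_sum_class_sums:
  assumes "1 \<le> j" "j \<le> m"
  shows "S = (\<Sum>a\<in>{a \<in> {0..<2 ^ j}. odd a}. class_sum j a)"
proof -
  have even: "even ((2::int) ^ j)" using assms(1) by simp
  let ?O = "{x \<in> {0..<2 ^ m}. odd (x::int)}" and ?D = "{a \<in> {0..<2 ^ j}. odd (a::int)}"
  have odd_mod: "odd (x mod 2 ^ j) \<longleftrightarrow> odd x" for x :: int
    using even dvd_mod_iff by blast
  have "finite ?O" by (rule finite_subset[of _ "{0..<2 ^ m}"]) auto
  moreover have "finite ?D" by (rule finite_subset[of _ "{0..<2 ^ j}"]) auto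
  moreover have "(\<lambda>x. x mod 2 ^ j) ` ?O \<subseteq> ?D"
  proof (rule image_subsetI)
    fix x assume "x \<in> ?O"
    then have "odd (x mod 2 ^ j)" by (subst odd_mod) simp
    then show "x mod 2 ^ j \<in> ?D" by simp
  qed
  ultimately have "S = (\<Sum>a\<in>?D. sum f {x \<in> ?O. x mod 2 ^ j = a})"
    unfolding S_odd by (rule sum.group[symmetric])
  also have "\<dots> = (\<Sum>a\<in>?D. class_sum j a)"
  proof (rule sum.cong[OF refl])
    fix a assume a: "a \<in> ?D"
    have "{x \<in> ?O. x mod 2 ^ j = a} = {x \<in> {0..<2 ^ m}. [x = a] (mod 2 ^ j)}"
    proof (intro Collect_cong)
      fix x
      have "x mod 2 ^ j = a \<longleftrightarrow> [x = a] (mod 2 ^ j)" using a by (simp add: cong_def)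
      moreover have "odd x" if "x mod 2 ^ j = a" using a that by (subst odd_mod[symmetric]) simp
      ultimately show "x \<in> ?O \<and> x mod 2 ^ j = a \<longleftrightarrow> x \<in> {0..<2 ^ m} \<and> [x = a] (mod 2 ^ j)"
        by blast
    qed
    then show "sum f {x \<in> ?O. x mod 2 ^ j = a} = class_sum j a" by (simp add: class_sum_def)
  qed
  finally show ?thesis .
qed

section \<open>Necessary conditions for a non-zero sum\<close>

lemma S_nonzero_imp_solution:
  assumes "S \<noteq> 0"
  obtains a where "odd a" "2 ^ (m - (N - t)) dvd C a"
proof -
  have "S = (\<Sum>a\<in>{a \<in> {0..<2 ^ (N - t)}. odd a}. class_sum (N - t) a)"
    using N_ge N_le by (intro S_eq_sum_class_sums) auto
  then obtain a where "odd a" "class_sum (N - t) a \<noteq> 0"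
    using assms by (metis (no_types, lifting) mem_Collect_eq sum.neutral)
  then show ?thesis using that class_sum_eq by metis
qed

text \<open>The substitution of \<open>-x\<close> for \<open>x\<close> gives
  \<open>S = - S\<close>.\<close>

lemma S_eq_0_if_chi1_odd:
  assumes "even k" "chi1 (- 1) \<noteq> 1"
  shows "S = 0"
proof -
  have "even ((2::int) ^ m)" using m_ge_3 by simp
  then have "S = (\<Sum>x\<in>{x \<in> {0..<2 ^ m}. odd x}. f (2 ^ m - x))"
    unfolding S_odd
    by (intro sum.reindex_bij_witness[of _ "\<lambda>x. 2 ^ m - x" "\<lambda>x. 2 ^ m - x"])
      (auto intro: Orderings.le_neq_trans)
  also have "\<dots> = (\<Sum>x\<in>{x \<in> {0..<2 ^ m}. odd x}. - f x)"
  proof (intro sum.cong refl)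
    fix x
    have "f (2 ^ m - x) = f (- x)" by (rule f_cong) (simp add: cong_def)
    also have "\<dots> = - f x" using f_minus[OF assms(1)] dchar_minus_1[OF chi1] assms(2) by simp
    finally show "f (2 ^ m - x) = - f x" .
  qed
  also have "\<dots> = - S" by (simp add: S_odd sum_negf)
  finally show ?thesis by simp
qed

lemma odd_C_coefficient: "odd x \<Longrightarrow> odd (c2 * A1 * int k1 * x ^ k * R N * Rinv)"
  using odd_c2 odd_A1 odd_k1 odd_Rinv odd_R[of N] N_ge by simp

text \<open>The second term of \<open>C\<close> carries the factor \<open>2 ^ (n + t)\<close>, and
  \<open>c1\<close> is multiplied by a unit in the first.\<close>

lemma solution_imp_dvd_c1:
  assumes "odd a" "2 ^ (m - (N - t)) dvd C a"
  shows "2 ^ (n + t) dvd c1"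
proof -
  have "(2::int) ^ (n + t) dvd 2 ^ (m - (N - t))" using N_ge N_le by (intro le_imp_power_dvd) simp
  then have "2 ^ (n + t) dvd C a" using assms(2) by (rule dvd_trans)
  then have "2 ^ (n + t) dvd c1 * (A * a ^ k + B)" unfolding C_eq by (simp add: dvd_add_left_iff)
  then show ?thesis using odd_argument[of a] by (simp add: coprime_dvd_mult_left_iff)
qed

text \<open>When \<open>N + n < m\<close> a solution provides one bit more than
  \<open>n + t\<close>; the odd second coefficient must then cancel against an odd first
  one.\<close>

lemma solution_imp_c1_exact:
  assumes "odd a" "2 ^ (m - (N - t)) dvd C a" "N + n < m"
  shows "\<exists>c3. odd c3 \<and> c1 = 2 ^ (n + t) * c3"
proof -
  obtain c3 where c3: "c1 = 2 ^ (n + t) * c3" using solution_imp_dvd_c1[OF assms(1,2)] by (elim dvdE)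
  have "(2::int) ^ Suc (n + t) dvd 2 ^ (m - (N - t))" using N_ge assms(3) by (intro le_imp_power_dvd) simp
  then have "2 ^ (n + t) * 2 dvd C a" using assms(2) by (metis dvd_trans power_Suc2)
  moreover have "C a = 2 ^ (n + t) * (c3 * (A * a ^ k + B) + c2 * A1 * int k1 * a ^ k * R N * Rinv)"
    by (rule trans[OF C_eq]) (simp add: c3 algebra_simps)
  ultimately have "even (c3 * (A * a ^ k + B) + c2 * A1 * int k1 * a ^ k * R N * Rinv)"
    by (simp only: dvd_mult_cancel_left) simp
  then have "odd c3" using odd_C_coefficient[OF assms(1)] odd_argument[of a] by simp
  then show ?thesis using c3 by blast
qed

subsection \<open>The sum in the range \<open>m - n \<le> 2 * t + 4\<close>\<close>

lemma f_1: "f 1 = chi2 (A + B)"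
  by (simp add: f_def dchar_1[OF chi1])

lemma f_minus_1: "odd k \<Longrightarrow> f (- 1) = chi1 (- 1) * chi2 (- A + B)"
  by (simp add: f_def)

text \<open>Classes without solutions have sum zero, so \<open>X\<close> has to cover the solutions
  but may also contain other classes.\<close>

lemma S_eq_class_representatives:
  assumes "finite X" and odd: "\<And>x. x \<in> X \<Longrightarrow> odd x"
    and inj: "inj_on (\<lambda>x. x mod 2 ^ (N - t)) X"
    and cover: "\<And>a. odd a \<Longrightarrow> 2 ^ (m - (N - t)) dvd C a \<Longrightarrow> \<exists>x\<in>X. [a = x] (mod 2 ^ (N - t))"
  shows "S = (\<Sum>x\<in>X. class_sum (N - t) x)"
proof -
  define j where "j = N - t"
  have j: "1 \<le> j" "j \<le> m" using N_ge N_le by (auto simp: j_def)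
  have even: "even ((2::int) ^ j)" using j by simp
  let ?D = "{a \<in> {0..<2 ^ j}. odd (a::int)}"
  have "S = (\<Sum>a\<in>?D. class_sum j a)" by (rule S_eq_sum_class_sums[OF j])
  also have "\<dots> = (\<Sum>a\<in>(\<lambda>x. x mod 2 ^ j) ` X. class_sum j a)"
  proof (rule sum.mono_neutral_right)
    show "finite ?D" by (rule finite_subset[of _ "{0..<2 ^ j}"]) auto
    show "(\<lambda>x. x mod 2 ^ j) ` X \<subseteq> ?D"
    proof (rule image_subsetI)
      fix x assume "x \<in> X"
      then have "odd (x mod 2 ^ j)" using odd dvd_mod_iff[OF even] by blast
      then show "x mod 2 ^ j \<in> ?D" by simp
    qed
    show "\<forall>a\<in>?D - (\<lambda>x. x mod 2 ^ j) ` X. class_sum j a = 0"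
    proof
      fix a assume a: "a \<in> ?D - (\<lambda>x. x mod 2 ^ j) ` X"
      have "\<not> 2 ^ (m - j) dvd C a"
      proof
        assume "2 ^ (m - j) dvd C a"
        then obtain x where "x \<in> X" "[a = x] (mod 2 ^ j)" using cover a unfolding j_def by blast
        moreover have "a mod 2 ^ j = a" using a by simp
        ultimately have "a \<in> (\<lambda>x. x mod 2 ^ j) ` X" by (metis cong_def image_eqI)
        then show False using a by blast
      qed
      then show "class_sum j a = 0" using a class_sum_eq[of a] by (simp add: j_def)
    qed
  qed
  also have "\<dots> = (\<Sum>x\<in>X. class_sum j (x mod 2 ^ j))"
    using sum.reindex[OF inj] by (simp add: j_def)
  also have "\<dots> = (\<Sum>x\<in>X. class_sum j x)"
    by (intro sum.cong refl class_sum_cong) (simp add: cong_def)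
  finally show ?thesis by (simp add: j_def)
qed

lemma S_two_classes:
  assumes "N = t + 2"
  shows "S = 2 ^ (m - 2) * ((if 2 ^ (m - 2) dvd C 1 then f 1 else 0)
      + (if 2 ^ (m - 2) dvd C (- 1) then f (- 1) else 0))"
proof -
  have j: "N - t = 2" using assms by simp
  have "S = (\<Sum>x\<in>{1, - 1}. class_sum (N - t) x)"
  proof (rule S_eq_class_representatives)
    fix a :: int assume "odd a"
    then have "a mod 4 = 1 \<or> a mod 4 = 3" by presburger
    then show "\<exists>x\<in>{1, - 1}. [a = x] (mod 2 ^ (N - t))" by (auto simp: j cong_def)
  qed (auto simp: j inj_on_def)
  then show ?thesis
    using class_sum_eq[of 1] class_sum_eq[of "- 1"] by (simp add: j distrib_left)
qed

lemma S_middle_range: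
  assumes N: "N = t + 2" and "t + 3 < m - n" and "2 ^ (n + t) dvd c1" and "even k \<Longrightarrow> chi1 (- 1) = 1"
  shows "S = (if even k \<and> [C 1 = 0] (mod 2 ^ (m - 2)) then 2 ^ (m - 1) * chi2 (A + B)
     else if odd k \<and> [C 1 = 0] (mod 2 ^ (m - 2)) then 2 ^ (m - 2) * chi2 (A + B)
     else if odd k \<and> [C (- 1) = 0] (mod 2 ^ (m - 2)) then 2 ^ (m - 2) * chi1 (- 1) * chi2 (- A + B)
     else 0)"
proof (cases "even k")
  case True
  have "(2::complex) ^ (m - 1) = 2 * 2 ^ (m - 2)"
    using m_ge_3 by (simp flip: power_Suc add: Suc_diff_Suc numeral_2_eq_2)
  then show ?thesis
    using True assms(4) f_minus[OF True, of 1] C_minus[OF True, of 1]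
    by (simp add: S_two_classes[OF N] cong_0_iff f_1)
next
  case False
  \<comment> \<open>The difference \<open>C 1 - C (- 1)\<close> is \<open>2 ^ (n + 1)\<close> times
    an odd number, while \<open>m - 2 >= n + 2\<close>. Hence at most one class survives and the
    order of the alternatives is immaterial.\<close>
  have "\<not> (2 ^ (m - 2) dvd C 1 \<and> 2 ^ (m - 2) dvd C (- 1))"
  proof
    assume "2 ^ (m - 2) dvd C 1 \<and> 2 ^ (m - 2) dvd C (- 1)"
    then have "2 ^ (m - 2) dvd C 1 - C (- 1)" by (intro dvd_diff) auto
    moreover have "C 1 - C (- 1) = 2 ^ (n + 1) * (A1 * (c1 + c2 * int k * R N * Rinv))"
    proof -
      have "C 1 - C (- 1) = 2 * A * (c1 + c2 * int k * R N * Rinv)"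
        using False by (simp add: C_def algebra_simps)
      also have "\<dots> = 2 ^ (n + 1) * (A1 * (c1 + c2 * int k * R N * Rinv))"
        unfolding A_eq by simp
      finally show ?thesis .
    qed
    moreover have "(2::int) ^ (n + 1) * 2 dvd 2 ^ (m - 2)"
      using le_imp_power_dvd[of "Suc (n + 1)" "m - 2" "2::int"] assms(2) by (simp add: mult.commute)
    ultimately have "2 ^ (n + 1) * 2 dvd 2 ^ (n + 1) * (A1 * (c1 + c2 * int k * R N * Rinv))"
      by (metis dvd_trans)
    then have "even (A1 * (c1 + c2 * int k * R N * Rinv))" by (simp only: dvd_mult_cancel_left) simp
    moreover have "even c1" using assms(3) n_pos by (meson add_pos_nonneg dvd_power dvd_trans le0)
    ultimately show False
      using odd_A1 odd_c2 False odd_Rinv odd_R[of N] N_ge by simp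
  qed
  then show ?thesis
    using False by (auto simp: S_two_classes[OF N] cong_0_iff f_1 f_minus_1)
qed

text \<open>Here \<open>2 ^ (m - 2) = 2 ^ (n + t) * 2\<close>, so \<open>chi1 5 = - 1\<close> and
  the characteristic condition is a parity condition, which every odd residue satisfies.\<close>

lemma S_t_plus_3:
  assumes m: "m - n = t + 3" and N: "N = t + 2" and c3: "c1 = 2 ^ (n + t) * c3" "odd c3"
    and "even k \<Longrightarrow> chi1 (- 1) = 1"
  shows "S = (if even k \<and> (chi1 5 = 1 \<or> chi1 5 = -1) \<and> chi1 (-1) = 1 then 2 ^ (m - 1) * chi2 (A + B)
     else if odd k \<and> (chi1 5 = 1 \<or> chi1 5 = -1)
       then 2 ^ (m - 2) * (chi2 (A + B) + chi1 (-1) * chi2 (- A + B))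
     else 0)"
proof -
  have m2: "m - 2 = Suc (n + t)" using m n_pos by simp
  have "chi1 5 = eq 2 c3"
    using eq_power2_cancel[of "n + t" "m - 2" c3] by (simp add: chi1_5 c3 m2)
  then have chi: "chi1 5 = - 1" using eq_2_odd[OF c3(2)] by simp
  have C: "2 ^ (m - 2) dvd C a" if "odd a" for a
  proof -
    have "C a = 2 ^ (n + t) * (c3 * (A * a ^ k + B) + c2 * A1 * int k1 * a ^ k * R N * Rinv)"
      by (rule trans[OF C_eq]) (simp add: c3(1) algebra_simps)
    moreover have "even (c3 * (A * a ^ k + B) + c2 * A1 * int k1 * a ^ k * R N * Rinv)"
      using odd_C_coefficient[OF that] odd_argument[of a] c3(2) by simp
    ultimately show ?thesis unfolding m2 by (simp add: mult_dvd_mono mult.commute)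
  qed
  have S: "S = 2 ^ (m - 2) * (f 1 + f (- 1))"
    using S_two_classes[OF N] C[of 1] C[of "- 1"] by simp
  have "(2::complex) ^ (m - 1) = 2 * 2 ^ (m - 2)"
    using m_ge_3 by (simp flip: power_Suc add: Suc_diff_Suc numeral_2_eq_2)
  then show ?thesis
    using assms(5) chi f_minus[of 1] f_minus_1 by (auto simp: S f_1)
qed

text \<open>Now \<open>m - 2 = n + t\<close>, so \<open>chi1 5 = 1\<close> and both classes survive.
  For odd \<open>k\<close> the two values of \<open>chi2\<close> are opposite, which leaves the
  factor \<open>1 - chi1 (- 1)\<close>.\<close>

lemma S_t_plus_2:
  assumes m: "m - n = t + 2" and N: "N = t + 2" and c1: "2 ^ (n + t) dvd c1"
    and even_k: "even k \<Longrightarrow> chi1 (- 1) = 1"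
  shows "S = (if (even k \<and> chi1 = chi0_2) \<or> (odd k \<and> chi1 = chi4)
     then 2 ^ (m - 1) * chi2 (A + B) else 0)"
proof -
  have m2: "m - 2 = n + t" using m n_pos by simp
  have chi: "chi1 5 = 1" using c1 by (simp add: chi1_5 m2 eq_eq_1_iff)
  have C: "2 ^ (m - 2) dvd C a" for a
    using c1 unfolding m2 C_eq by simp
  have S: "S = 2 ^ (m - 2) * (f 1 + f (- 1))"
    using S_two_classes[OF N] C[of 1] C[of "- 1"] by simp
  have two: "(2::complex) ^ (m - 1) = 2 * 2 ^ (m - 2)"
    using m_ge_3 by (simp flip: power_Suc add: Suc_diff_Suc numeral_2_eq_2)
  have "2 \<le> m" using m_ge_3 by simp
  note triv = dchar_trivial_at_5[OF chi1 this chi]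
  show ?thesis
  proof (cases "even k")
    case True
    then have cond: "(even k \<and> chi1 = chi0_2) \<or> (odd k \<and> chi1 = chi4)"
      using triv(1) even_k by blast
    have "S = 2 ^ (m - 1) * chi2 (A + B)"
      using even_k[OF True] f_minus[OF True, of 1] two by (simp add: S f_1)
    then show ?thesis unfolding if_P[OF cond] .
  next
    case False
    have t: "t = 0" using False by (cases t) (auto simp: k_eq)
    \<comment> \<open>As \<open>t = 0\<close>, subtracting \<open>2 * A\<close> is a shift by an odd
      multiple of \<open>2 ^ (m - 1)\<close>; since \<open>c2\<close> is odd, it changes the
      sign.\<close>
    have "chi2 ((A + B) + 2 ^ (m - 1) * - A1) = chi2 (A + B) * eq (2 ^ (m - (m - 1))) (c2 * 1)"
    proof (rule dchar_shift[OF chi2 chi2_5])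
      have "odd (R (m - 1))" using m_ge_3 by (intro odd_R) simp
      then have "[1 * R (m - 1) * (A + B) = - A1] (mod 2)"
        using odd_A1 odd_argument[of 1] by (simp add: cong_iff_dvd_diff)
      then show "[1 * R (m - 1) * (A + B) = - A1] (mod 2 ^ (m - (m - 1)))"
        using m_ge_3 by simp
    qed (use m_ge_3 in auto)
    also have "(A + B) + 2 ^ (m - 1) * - A1 = - A + B"
    proof -
      have "m - 1 = Suc n" using m t by simp
      then show ?thesis by (simp add: A_eq)
    qed
    also have "chi2 (A + B) * eq (2 ^ (m - (m - 1))) (c2 * 1) = - chi2 (A + B)"
      using m_ge_3 eq_2_odd[OF odd_c2] by simp
    finally have "chi2 (- A + B) = - chi2 (A + B)" .
    then have S': "S = 2 ^ (m - 2) * ((1 - chi1 (- 1)) * chi2 (A + B))"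
      using False by (simp add: S f_1 f_minus_1 algebra_simps)
    show ?thesis
    proof (cases "chi1 (- 1) = 1")
      case True
      have "chi4 (- 1) = - 1" by (simp add: chi4_def)
      then have "chi1 \<noteq> chi4" using True by (metis one_neq_neg_one)
      then have "\<not> ((even k \<and> chi1 = chi0_2) \<or> (odd k \<and> chi1 = chi4))" using False by blast
      moreover have "S = 0" using S' True by simp
      ultimately show ?thesis by (simp only: if_False)
    next
      case neg: False
      then have neg: "chi1 (- 1) = - 1" using dchar_minus_1[OF chi1] by blast
      then have cond: "(even k \<and> chi1 = chi0_2) \<or> (odd k \<and> chi1 = chi4)"
        using triv(2) False by blast
      have "S = 2 ^ (m - 1) * chi2 (A + B)" using S' neg two by simp
      then show ?thesis unfolding if_P[OF cond] .
    qed
  qed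
qed

subsection \<open>The sum in the range \<open>m - n > 2 * t + 4\<close>\<close>

lemma C_diff:
  assumes "c1 = 2 ^ (n + t) * c3"
  shows "C a - C b = 2 ^ (n + t) * ((c3 * A + c2 * A1 * int k1 * R N * Rinv) * (a ^ k - b ^ k))"
  unfolding C_eq[of a] C_eq[of b] by (simp add: assms algebra_simps)

lemma odd_C_diff_coefficient: "odd (c3 * A + c2 * A1 * int k1 * R N * Rinv)"
  using even_A odd_C_coefficient[of 1] by simp

lemma solution_modulus: "m - (N - t) = (n + t) + (m - n - N)"
  using N_ge N_le by simp

lemma solutions_power_cong:
  assumes "c1 = 2 ^ (n + t) * c3" "2 ^ (m - (N - t)) dvd C a"
  shows "2 ^ (m - (N - t)) dvd C b \<longleftrightarrow> [b ^ k = a ^ k] (mod 2 ^ (m - n - N))"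
proof -
  have "2 ^ (m - (N - t)) dvd C b \<longleftrightarrow> 2 ^ (m - (N - t)) dvd C b - C a"
    using assms(2) by (simp add: dvd_diff_left_iff)
  also have "\<dots> \<longleftrightarrow> 2 ^ (m - n - N) dvd (c3 * A + c2 * A1 * int k1 * R N * Rinv) * (b ^ k - a ^ k)"
    unfolding C_diff[OF assms(1)] solution_modulus power_add[of _ "n + t"]
    by (simp only: dvd_mult_cancel_left) simp
  also have "\<dots> \<longleftrightarrow> 2 ^ (m - n - N) dvd b ^ k - a ^ k"
    using odd_C_diff_coefficient[of c3] by (intro coprime_dvd_mult_right_iff) simp
  finally show ?thesis by (simp add: cong_iff_dvd_diff)
qed

text \<open>Extracting the \<open>2 ^ t\<close>-th root from the congruence of \<open>k\<close>-th
  powers costs \<open>t\<close> bits.\<close>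

lemma solutions_cong:
  assumes "c1 = 2 ^ (n + t) * c3" "odd a" "2 ^ (m - (N - t)) dvd C a" "odd b" "2 ^ (m - (N - t)) dvd C b"
    and "t \<le> m - n - N"
  shows "[b = a] (mod 2 ^ (m - n - N - t)) \<or> t > 0 \<and> [b = - a] (mod 2 ^ (m - n - N - t))"
  using solutions_power_cong[OF assms(1,3), of b] assms(2,4,5,6) odd_k1
  unfolding k_eq by (intro equal_powers_cong) auto

text \<open>Here \<open>m - n - N - t = N - t\<close>, so the solutions fill the class of
  \<open>x0\<close> and, for even \<open>k\<close>, that of \<open>- x0\<close> with the same sum;
  this is the factor \<open>2 ^ min 1 t\<close>.\<close>

lemma S_even_case:
  assumes c1: "c1 = 2 ^ (n + t) * c3" and N: "m - n = 2 * N"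
    and x0: "odd x0" "2 ^ (m - (N - t)) dvd C x0" and even_k: "even k \<Longrightarrow> chi1 (- 1) = 1"
  shows "S = 2 ^ (m - (N - t) + min 1 t) * f x0"
proof (cases "t = 0")
  case True
  have "S = (\<Sum>x\<in>{x0}. class_sum (N - t) x)"
  proof (rule S_eq_class_representatives)
    fix a assume "odd a" "2 ^ (m - (N - t)) dvd C a"
    then show "\<exists>x\<in>{x0}. [a = x] (mod 2 ^ (N - t))"
      using solutions_cong[OF c1 x0, of a] True N by simp
  qed (use x0 in auto)
  then show ?thesis using class_sum_eq[OF x0(1)] x0(2) True by simp
next
  case False
  then have k: "even k" by (simp add: k_eq)
  have nc: "x0 mod 2 ^ (N - t) \<noteq> - x0 mod 2 ^ (N - t)"
  proof
    assume "x0 mod 2 ^ (N - t) = - x0 mod 2 ^ (N - t)"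
    then have "2 ^ (N - t) dvd 2 * x0" by (simp add: mod_eq_dvd_iff)
    moreover have "(2::int) * 2 dvd 2 ^ (N - t)" using le_imp_power_dvd[of 2 "N - t" "2::int"] N_ge by simp
    ultimately have "2 * 2 dvd 2 * x0" using dvd_trans by blast
    then show False using x0(1) by (simp only: dvd_mult_cancel_left) simp
  qed
  have "S = (\<Sum>x\<in>{x0, - x0}. class_sum (N - t) x)"
  proof (rule S_eq_class_representatives)
    fix a assume "odd a" "2 ^ (m - (N - t)) dvd C a"
    then show "\<exists>x\<in>{x0, - x0}. [a = x] (mod 2 ^ (N - t))"
      using solutions_cong[OF c1 x0, of a] N_ge N by auto
  qed (use x0 nc in \<open>auto simp: inj_on_def\<close>)
  also have "\<dots> = class_sum (N - t) x0 + class_sum (N - t) (- x0)"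
    using x0(1) by (subst sum.insert) auto
  also have "\<dots> = 2 ^ (m - (N - t)) * f x0 + 2 ^ (m - (N - t)) * f x0"
    using class_sum_eq[of x0] class_sum_eq[of "- x0"] x0 C_minus[OF k] f_minus[OF k] even_k[OF k] by simp
  finally show ?thesis using False by simp
qed

text \<open>
  The multiplier is a square root of the generator in \<open>f_mult_5_power\<close>, so the expansion of its \<open>k\<close>-th
  power needs the quadratic term as well. Passing from \<open>R (N - 1)\<close> and \<open>R (N + n - 1)\<close> to \<open>R N\<close> and
  \<open>R (N + n)\<close>, as they occur in \<open>C\<close>, produces the corrections \<open>- G\<close> and \<open>2 ^ n * T\<close> to \<open>2 * lam\<close>.
\<close>
lemma f_mult_half_generator:
  assumes c1: "c1 = 2 ^ (n + t) * c3" "odd c3" and m: "m = n + 2 * N - 1" and N: "N \<ge> t + 3"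
    and x0: "odd x0" "C x0 = lam * 2 ^ (m - (N - t))"
  shows "f (x0 * 5 ^ (2 ^ (N - t - 3))) =
    f x0 * eq 4 (2 * lam + (int k1 - 1) + (2 ^ n - 1) * c3)"
proof -
  define v where "v = A * x0 ^ k + B"
  obtain D where D: "[v * D = 1] (mod 2 ^ m)" unfolding v_def by (rule argument_inverse)
  have odd_v: "odd v" unfolding v_def by (rule odd_argument)
  have odd_D: "odd D"
  proof
    assume "even D"
    moreover have "[v * D = 1] (mod 2)"
      using D m_ge_3 by (meson cong_dvd_modulus dvd_power less_le_trans zero_less_numeral)
    ultimately show False by (simp add: cong_def mod2_eq_if)
  qed
  \<comment> \<open>One level below that used for the full generator; the surviving modulus is
    \<open>2 ^ (m - i) = 2 ^ N\<close>.\<close>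
  define i where "i = N + n - 1"
  have i: "i \<ge> 2" "i \<le> m" "m \<le> 2 * i" "m - i = N" "Suc i = N + n" "i - 1 = (N - 2) + n" "i = (N - 1) + n"
    using N n_pos by (auto simp: i_def m)
  define r where "r = R (N - 1)"
  define q where "q = int k1 * r + int (k1 choose 2) * r ^ 2 * 2 ^ (N - 1)"
  define G where "G = c2 * A1 * x0 ^ k * D * Rinv"
  \<comment> \<open>By \<open>R_Suc\<close>,
    \<open>R (N + n) = R i * (1 + R i * 2 ^ (i - 1))\<close>, so the first two factors invert
    \<open>R i\<close>.\<close>
  define g where "g = (1 + R i * 2 ^ (i - 1)) * Rinv * D * A1 * x0 ^ k * q"
  have odd_G: "odd G" using odd_c2 odd_A1 x0(1) odd_D odd_Rinv by (simp add: G_def)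
  have le_m: "[x = y] (mod 2 ^ N)" if "[x = y] (mod 2 ^ m)" for x y :: int
    using that i(2,4) by (metis cong_dvd_modulus diff_le_self le_imp_power_dvd)

  have chi1_u: "chi1 (5 ^ 2 ^ (N - t - 3)) = eq (2 ^ N) c3"
  proof -
    have e: "N - t - 1 - 2 = N - t - 3" "m - (N - t - 1) = N + (n + t)" using N m n_pos by auto
    have "chi1 (5 ^ 2 ^ (N - t - 3)) = eq (2 ^ (N + (n + t))) c1"
    proof -
      have "2 \<le> N - t - 1" "N - t - 1 \<le> m" using N i(2) by (auto simp: i_def)
      from dchar_5_power[OF chi1 chi1_5 this, of 1] show ?thesis unfolding e by simp
    qed
    also have "\<dots> = eq (2 ^ N) c3"
      using eq_power2_cancel[of "n + t" "N + (n + t)" c3] by (simp add: c1(1))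
    finally show ?thesis .
  qed

  have chi2_u: "chi2 (A * (x0 * 5 ^ 2 ^ (N - t - 3)) ^ k + B) = chi2 v * eq (2 ^ N) (c2 * g)"
  proof -
    let ?x = "r * 2 ^ (N - 1)"
    have "2 ^ (N - t - 3) * k = 2 ^ (N - 1 - 2) * k1"
    proof -
      have "N - 1 - 2 = (N - t - 3) + t" using N by simp
      then show ?thesis by (simp only: k_eq power_add mult.assoc)
    qed
    moreover have "(5::int) ^ 2 ^ (N - 1 - 2) = 1 + ?x"
      using R_expansion[of "N - 1"] N by (simp add: r_def)
    ultimately have "(x0 * 5 ^ 2 ^ (N - t - 3)) ^ k = x0 ^ k * (1 + ?x) ^ k1"
      by (simp only: power_mult_distrib power_mult[symmetric]) (simp only: power_mult)
    then have pow: "A * (x0 * 5 ^ 2 ^ (N - t - 3)) ^ k + B = A1 * x0 ^ k * (2 ^ n * (1 + ?x) ^ k1) + B"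
      by (simp add: A_eq)
    have "[(1 + ?x) ^ k1 = 1 + int k1 * ?x + int (k1 choose 2) * ?x ^ 2] (mod 2 ^ (2 * N - 1))"
    proof (rule cong_dvd_modulus[OF one_plus_power_cong3])
      have "(2::int) ^ (2 * N - 1) dvd 2 ^ ((N - 1) * 3)" using N by (intro le_imp_power_dvd) simp
      then show "2 ^ (2 * N - 1) dvd ?x ^ 3"
        by (simp add: power_mult_distrib power_mult[symmetric])
    qed
    then have "[A1 * x0 ^ k * (2 ^ n * (1 + ?x) ^ k1) + B
        = A1 * x0 ^ k * (2 ^ n * (1 + int k1 * ?x + int (k1 choose 2) * ?x ^ 2)) + B] (mod 2 ^ m)"
      using m N by (intro cong_add cong_refl cong_scalar_left cong_power2_mult[of _ _ "2 * N - 1"]) auto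
    also have "A1 * x0 ^ k * (2 ^ n * (1 + int k1 * ?x + int (k1 choose 2) * ?x ^ 2)) + B
        = v + 2 ^ i * (A1 * x0 ^ k * q)"
      unfolding v_def A_eq i(7) power_add q_def by (simp add: power2_eq_square algebra_simps)
    finally have "chi2 (A * (x0 * 5 ^ 2 ^ (N - t - 3)) ^ k + B) = chi2 (v + 2 ^ i * (A1 * x0 ^ k * q))"
      unfolding pow by (rule dchar_cong[OF chi2])
    also have "\<dots> = chi2 v * eq (2 ^ (m - i)) (c2 * g)"
    proof (rule dchar_shift[OF chi2 chi2_5 i(1-3)])
      have "R (N + n) = R i * (1 + R i * 2 ^ (i - 1))"
        using R_Suc[OF i(1)] by (simp add: i(5) power2_eq_square algebra_simps)
      then have "[R i * (1 + R i * 2 ^ (i - 1)) * Rinv = 1] (mod 2 ^ m)" using Rinv by simp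
      then have "[(R i * (1 + R i * 2 ^ (i - 1)) * Rinv) * (v * D) * (A1 * x0 ^ k * q)
          = 1 * 1 * (A1 * x0 ^ k * q)] (mod 2 ^ m)"
        by (intro cong_mult D cong_refl)
      then have "[g * R i * v = A1 * x0 ^ k * q] (mod 2 ^ m)"
        by (simp add: g_def mult_ac)
      then show "[g * R i * v = A1 * x0 ^ k * q] (mod 2 ^ (m - i))"
        unfolding i(4) by (rule le_m)
    qed
    finally show ?thesis by (simp add: i(4))
  qed

  \<comment> \<open>Replacing \<open>R (N - 1)\<close> by \<open>R N\<close> costs
    \<open>2 ^ (N - 2)\<close>: the remaining factor is divisible by 4 because \<open>r ^ 2\<close>
    and \<open>k1 * (2 - k1)\<close> are both 1 modulo 4.\<close>
  have q: "[q = int k1 * R N - 2 ^ (N - 2)] (mod 2 ^ N)"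
  proof -
    have N2: "Suc (N - 1) = N" "N - 1 - 1 = N - 2" "N - 1 = Suc (N - 2)" using N by auto
    have RN: "R N = r + r ^ 2 * 2 ^ (N - 2)"
      using R_Suc[of "N - 1"] N unfolding N2(1,2) r_def by simp
    have ch: "2 * int (k1 choose 2) = int k1 * (int k1 - 1)"
    proof -
      have "2 * (k1 choose 2) = k1 * (k1 - 1)"
        unfolding choose_two by (rule dvd_mult_div_cancel) auto
      then have "int (2 * (k1 choose 2)) = int (k1 * (k1 - 1))" by (simp only:)
      then show ?thesis using odd_k1 by (cases k1) (auto simp: algebra_simps)
    qed
    obtain p where p: "int k1 = 2 * p + 1" using odd_k1 by (metis even_of_nat oddE)
    have "odd r" using N by (simp add: r_def odd_R)
    then obtain s where s: "r = 2 * s + 1" by (elim oddE)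
    have "q = int k1 * r + (2 * int (k1 choose 2)) * r ^ 2 * 2 ^ (N - 2)"
      unfolding q_def N2(3) by simp
    then have "q - (int k1 * R N - 2 ^ (N - 2)) = 2 ^ (N - 2) * (1 - r ^ 2 * int k1 * (2 - int k1))"
      unfolding RN ch by (simp add: algebra_simps power2_eq_square)
    also have "1 - r ^ 2 * int k1 * (2 - int k1) = 2 ^ 2 * (- s * (s + 1) + r ^ 2 * p ^ 2)"
      unfolding p s by (simp add: algebra_simps power2_eq_square)
    also have "2 ^ (N - 2) * (2 ^ 2 * (- s * (s + 1) + r ^ 2 * p ^ 2))
        = 2 ^ N * (- s * (s + 1) + r ^ 2 * p ^ 2)"
    proof -
      have "N - 2 + 2 = N" using N by simp
      then have "(2::int) ^ N = 2 ^ (N - 2) * 2 ^ 2" by (metis power_add)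
      then show ?thesis by (simp only: mult.assoc)
    qed
    finally show ?thesis by (simp add: cong_iff_dvd_diff)
  qed

  \<comment> \<open>Modulo \<open>2 ^ N\<close> this is \<open>C x0\<close> divided by
    \<open>2 ^ (n + t) * v\<close>. The odd \<open>v\<close> then drops out, since it does not
    affect a multiple of \<open>2 ^ (N - 1)\<close>.\<close>
  define W where "W = c3 + G * int k1 * R N"
  have W: "[W = lam * 2 ^ (N - 1)] (mod 2 ^ N)"
  proof -
    have e: "m - (N - t) = (n + t) + (N - 1)" using N m by simp
    have "2 ^ (n + t) * (c3 * v + c2 * A1 * int k1 * x0 ^ k * R N * Rinv) = C x0"
      by (rule trans[OF _ C_eq[symmetric]]) (simp add: c1(1) v_def algebra_simps)
    also have "\<dots> = 2 ^ (n + t) * (lam * 2 ^ (N - 1))" by (simp add: x0(2) e power_add)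
    finally have *: "c3 * v + c2 * A1 * int k1 * x0 ^ k * R N * Rinv = lam * 2 ^ (N - 1)" by simp
    have "[c3 * v + (v * D) * (c2 * A1 * int k1 * x0 ^ k * R N * Rinv)
        = c3 * v + 1 * (c2 * A1 * int k1 * x0 ^ k * R N * Rinv)] (mod 2 ^ m)"
      by (intro cong_add cong_mult D cong_refl)
    also have "c3 * v + (v * D) * (c2 * A1 * int k1 * x0 ^ k * R N * Rinv) = v * W"
      by (simp add: W_def G_def algebra_simps)
    finally have vW: "[v * W = lam * 2 ^ (N - 1)] (mod 2 ^ N)" using * by (simp add: le_m)
    obtain s where s: "v = 2 * s + 1" using odd_v by (elim oddE)
    have NN: "(2::int) ^ N = 2 ^ (N - 1) * 2" using N by (cases N) auto
    have "[v * W = lam * 2 ^ (N - 1)] (mod 2 ^ (N - 1))"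
      using vW by (rule cong_dvd_modulus) (simp add: NN)
    then have "2 ^ (N - 1) dvd v * W" by (simp add: cong_def mod_eq_0_iff_dvd)
    then have "2 ^ (N - 1) dvd W" using odd_v by (simp add: coprime_dvd_mult_right_iff)
    then have "2 ^ N dvd 2 * s * W"
      unfolding NN by (metis dvd_triv_left mult.assoc mult.commute mult_dvd_mono)
    then have "[v * W = W] (mod 2 ^ N)" by (simp add: s cong_iff_dvd_diff algebra_simps)
    then show ?thesis using vW by (metis cong_sym cong_trans)
  qed

  \<comment> \<open>Modulo 4, \<open>W\<close> vanishes, \<open>R N\<close> is -1 and
    \<open>k1 ^ 2\<close> is 1.\<close>
  have G: "[G = c3 * int k1] (mod 4)"
  proof -
    have 4: "(4::int) dvd 2 ^ (N - 1)" "(4::int) dvd 2 ^ N"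
      using le_imp_power_dvd[of 2 "N - 1" "2::int"] le_imp_power_dvd[of 2 "N" "2::int"] N by auto
    have "4 dvd W"
      using cong_dvd_modulus[OF W 4(2)] 4(1) by (simp add: cong_dvd_iff dvd_mult)
    moreover have "4 dvd R N - 3" using R_mod_4[of N] N by (simp add: cong_iff_dvd_diff)
    ultimately obtain y z where yz: "W = 4 * y" "R N = 3 + 4 * z" by (metis add.commute diff_add_cancel dvdE)
    obtain p where p: "int k1 = 2 * p + 1" using odd_k1 by (metis even_of_nat oddE)
    have "G - c3 * int k1 = 4 * (- int k1 * y + G * int k1 ^ 2 * (1 + z) - G * (p ^ 2 + p))"
    proof -
      have "c3 = 4 * y - G * int k1 * (3 + 4 * z)" using yz unfolding W_def by simp
      then show ?thesis by (simp only: p) (simp add: algebra_simps power2_eq_square)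
    qed
    then show ?thesis by (simp add: cong_iff_dvd_diff)
  qed

  define h where "h = 2 * lam + (int k1 - 1) + (2 ^ n - 1) * c3"
  define T where "T = G * R i * (int k1 * R N - 2 ^ (N - 2))"
  have "[c3 + c2 * g = 2 ^ (N - 2) * h] (mod 2 ^ N)"
  proof -
    have "c2 * g = G * (1 + R i * 2 ^ (i - 1)) * q" by (simp add: g_def G_def)
    then have "[c3 + c2 * g = c3 + G * (1 + R i * 2 ^ (i - 1)) * (int k1 * R N - 2 ^ (N - 2))] (mod 2 ^ N)"
      using q by (simp add: cong_add cong_scalar_left)
    also have "c3 + G * (1 + R i * 2 ^ (i - 1)) * (int k1 * R N - 2 ^ (N - 2))
        = W + 2 ^ (N - 2) * (2 ^ n * T - G)"
      unfolding i(6) power_add W_def T_def by (simp add: algebra_simps)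
    also have "[\<dots> = lam * 2 ^ (N - 1) + 2 ^ (N - 2) * (2 ^ n * T - G)] (mod 2 ^ N)"
      by (intro cong_add W cong_refl)
    also have "lam * 2 ^ (N - 1) + 2 ^ (N - 2) * (2 ^ n * T - G)
        = 2 ^ (N - 2) * (2 * lam + 2 ^ n * T - G)"
    proof -
      have "N - 1 = Suc (N - 2)" using N by simp
      then show ?thesis by (simp add: algebra_simps)
    qed
    \<comment> \<open>Only the residue modulo 4 counts. There \<open>2 ^ n * T\<close> equals
      \<open>2 ^ n * c3\<close>, as \<open>T\<close> and \<open>c3\<close> are odd, and
      \<open>- c3 * k1\<close> equals \<open>(k1 - 1) - c3\<close>, as
      \<open>(k1 - 1) * (c3 + 1)\<close> is divisible by 4.\<close>
    also have "[\<dots> = 2 ^ (N - 2) * h] (mod 2 ^ N)"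
    proof (rule cong_power2_mult[of _ _ 2])
      have "odd T" using odd_G odd_R[OF i(1)] odd_R[of N] odd_k1 N by (simp add: T_def)
      then obtain e1 where e1: "T = 2 * e1 + 1" by (elim oddE)
      obtain e2 where e2: "int k1 = 2 * e2 + 1" using odd_k1 by (metis even_of_nat oddE)
      obtain e3 where e3: "c3 = 2 * e3 + 1" using c1(2) by (elim oddE)
      obtain e4 where e4: "(2::int) ^ n = 2 * e4" using n_pos by (cases n) auto
      have "4 dvd G - c3 * int k1" using G by (simp add: cong_iff_dvd_diff)
      then obtain e5 where e5: "G = c3 * int k1 + 4 * e5" by (metis add.commute diff_add_cancel dvdE)
      have "2 * lam + 2 ^ n * T - G - h = 4 * (e4 * e1 - e2 - e4 * e3 - e2 * e3 - e5)"
        unfolding h_def e5 e1 e2 e3 e4 by (simp add: algebra_simps)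
      then show "[2 * lam + 2 ^ n * T - G = h] (mod 2 ^ 2)" by (simp add: cong_iff_dvd_diff)
    qed (use N in simp)
    finally show ?thesis .
  qed
  then have "eq (2 ^ N) (c3 + c2 * g) = eq (2 ^ N) (2 ^ (N - 2) * h)" by (intro eq_cong) auto
  also have "\<dots> = eq 4 h" using eq_power2_cancel[of "N - 2" N h] N by simp
  finally have "eq (2 ^ N) c3 * eq (2 ^ N) (c2 * g) = eq 4 h" by (simp add: eq_add)
  then show ?thesis
    unfolding f_def dchar_mult[OF chi1] chi2_u chi1_u v_def[symmetric] h_def by (simp add: mult_ac)
qed

text \<open>Solutions are determined up to sign only modulo \<open>2 ^ (j - 1)\<close>, and each
  such class splits into two modulo \<open>2 ^ j\<close>, represented by \<open>x0\<close> and
  \<open>y = x0 * u\<close> or their negatives.\<close>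

lemma S_odd_case:
  assumes c1: "c1 = 2 ^ (n + t) * c3" "odd c3" and m: "m = n + 2 * N - 1" and N: "N \<ge> t + 3"
    and x0: "odd x0" "C x0 = lam * 2 ^ (m - (N - t))" and even_k: "even k \<Longrightarrow> chi1 (- 1) = 1"
  shows "S = 2 ^ (m - (N - t) + min 1 t) * f x0 * (1 + eq 4 (2 * lam + (int k1 - 1) + (2 ^ n - 1) * c3))"
proof -
  define j where "j = N - t"
  define u :: int where "u = 5 ^ (2 ^ (N - t - 3))"
  define y where "y = x0 * u"
  have j: "j \<ge> 3" using N by (simp add: j_def)
  have J: "(2::int) ^ j = 2 ^ (j - 1) * 2" using j by (cases j) auto
  have F: "m - n - N = N - 1" "N - 1 - t = j - 1" using m N by (auto simp: j_def)
  have "j - 1 - 2 = N - t - 3" by (simp add: j_def)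
  then have u: "u = 1 + R (j - 1) * 2 ^ (j - 1)"
    using R_expansion[of "j - 1"] j by (simp add: u_def)
  have odd_Rj: "odd (R (j - 1))" using j by (intro odd_R) simp
  have y: "odd y" using x0(1) by (simp add: y_def u_def)
  have C0: "2 ^ (m - j) dvd C x0" by (simp add: x0(2) j_def)
  \<comment> \<open>\<open>u ^ k\<close> is 1 modulo \<open>2 ^ (N - 1)\<close>, the precision to
    which solutions fix \<open>x ^ k\<close>.\<close>
  have Cy: "2 ^ (m - j) dvd C y"
  proof -
    have "2 ^ (N - t - 3) * k = 2 ^ (N - 1 - 2) * k1"
    proof -
      have "N - 1 - 2 = (N - t - 3) + t" using N by simp
      then show ?thesis by (simp only: k_eq power_add mult.assoc)
    qed
    then have "y ^ k = x0 ^ k * 5 ^ (2 ^ (N - 1 - 2) * k1)"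
      by (simp only: y_def u_def power_mult_distrib power_mult[symmetric])
    also have "[\<dots> = x0 ^ k * 1] (mod 2 ^ (N - 1))"
      using N by (intro cong_scalar_left cong_5_power_1) simp
    finally show ?thesis
      using solutions_power_cong[OF c1(1), of x0 y] C0 F(1) by (simp add: j_def)
  qed
  have fy: "f y = f x0 * eq 4 (2 * lam + (int k1 - 1) + (2 ^ n - 1) * c3)"
    unfolding y_def u_def by (rule f_mult_half_generator[OF c1 m N x0])
  \<comment> \<open>Multiplication by \<open>u\<close> flips exactly the bit of weight
    \<open>2 ^ (j - 1)\<close> modulo \<open>2 ^ j\<close>.\<close>
  have lift: "[a = z] (mod 2 ^ j) \<or> [a = z * u] (mod 2 ^ j)"
    if xz: "[a = z] (mod 2 ^ (j - 1))" "odd z" for a z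
  proof -
    obtain w where w: "a - z = 2 ^ (j - 1) * w" using xz(1) unfolding cong_iff_dvd_diff by (elim dvdE)
    show ?thesis
    proof (cases "even w")
      case True
      then show ?thesis by (auto simp: cong_iff_dvd_diff w J)
    next
      case False
      have "a - z * u = 2 ^ (j - 1) * (w - z * R (j - 1))"
        using w by (simp add: u algebra_simps)
      moreover have "even (w - z * R (j - 1))" using False xz(2) odd_Rj by simp
      ultimately show ?thesis by (auto simp: cong_iff_dvd_diff J)
    qed
  qed
  have n1: "x0 mod 2 ^ j \<noteq> y mod 2 ^ j"
  proof
    assume "x0 mod 2 ^ j = y mod 2 ^ j"
    then have "2 ^ j dvd y - x0" by (metis mod_eq_dvd_iff)
    also have "y - x0 = 2 ^ (j - 1) * (x0 * R (j - 1))" by (simp add: y_def u algebra_simps)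
    finally have "even (x0 * R (j - 1))" unfolding J by (simp only: dvd_mult_cancel_left) simp
    then show False using x0(1) odd_Rj by simp
  qed
  have sol: "[a = x0] (mod 2 ^ (j - 1)) \<or> t > 0 \<and> [a = - x0] (mod 2 ^ (j - 1))"
    if "odd a" "2 ^ (m - (N - t)) dvd C a" for a
    using solutions_cong[OF c1(1) x0(1) _ that] C0 N unfolding F by (simp add: j_def)
  show ?thesis
  proof (cases "t = 0")
    case True
    have "S = (\<Sum>x\<in>{x0, y}. class_sum (N - t) x)"
    proof (rule S_eq_class_representatives)
      fix a assume "odd a" "2 ^ (m - (N - t)) dvd C a"
      then show "\<exists>x\<in>{x0, y}. [a = x] (mod 2 ^ (N - t))"
        using sol[of a] lift[of a x0] x0(1) True by (auto simp: y_def j_def)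
    qed (use x0 y n1 in \<open>auto simp: inj_on_def j_def\<close>)
    also have "\<dots> = class_sum j x0 + class_sum j y" using n1 by (subst sum.insert) (auto simp: j_def)
    also have "\<dots> = 2 ^ (m - j) * f x0 + 2 ^ (m - j) * f y"
      using class_sum_eq[OF x0(1)] class_sum_eq[OF y] C0 Cy by (simp add: j_def)
    finally show ?thesis unfolding fy using True by (simp add: j_def algebra_simps)
  next
    case False
    then have k: "even k" by (simp add: k_eq)
    have "[u = 1] (mod 4)"
      using le_imp_power_dvd[of 2 "j - 1" "2::int"] j by (simp add: u cong_iff_dvd_diff)
    \<comment> \<open>As \<open>x0\<close> and \<open>y\<close> are odd and agree modulo 4, neither
      can meet a negative of either, so the four classes are distinct.\<close>
    then have y4: "[x0 = y] (mod 4)"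
      using cong_scalar_left[of u 1 4 x0] by (simp add: y_def cong_sym_eq)
    have nm: "x0 mod 2 ^ j \<noteq> - x0 mod 2 ^ j" "x0 mod 2 ^ j \<noteq> - y mod 2 ^ j"
      "y mod 2 ^ j \<noteq> - x0 mod 2 ^ j" "y mod 2 ^ j \<noteq> - y mod 2 ^ j"
      using x0(1) y y4 cong_sym[OF y4] j by (simp_all add: odd_not_cong_minus)
    have n2: "- x0 mod 2 ^ j \<noteq> - y mod 2 ^ j"
      using n1 by (metis minus_minus mod_minus_eq)
    have "S = (\<Sum>x\<in>{x0, y, - x0, - y}. class_sum (N - t) x)"
    proof (rule S_eq_class_representatives)
      fix a assume "odd a" "2 ^ (m - (N - t)) dvd C a"
      then show "\<exists>x\<in>{x0, y, - x0, - y}. [a = x] (mod 2 ^ (N - t))"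
        using sol[of a] lift[of a x0] lift[of a "- x0"] x0(1) by (auto simp: y_def j_def)
    next
      show "inj_on (\<lambda>x. x mod 2 ^ (N - t)) {x0, y, - x0, - y}"
        using n1 n2 nm unfolding j_def[symmetric] inj_on_def by (metis empty_iff insert_iff)
    qed (use x0 y in auto)
    also have "\<dots> = class_sum j x0 + (class_sum j y + (class_sum j (- x0) + class_sum j (- y)))"
    proof -
      have "x0 \<noteq> y" "x0 \<noteq> - x0" "x0 \<noteq> - y" "y \<noteq> - x0" "y \<noteq> - y" "- x0 \<noteq> - y"
        using n1 n2 nm by metis+
      then show ?thesis by (simp add: j_def)
    qed
    also have "\<dots> = 2 ^ (m - j) * (2 * (f x0 + f y))"
      using class_sum_eq[OF x0(1)] class_sum_eq[OF y] class_sum_eq[of "- x0"] class_sum_eq[of "- y"]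
        x0(1) y C0 Cy C_minus[OF k] f_minus[OF k] even_k[OF k]
      by (simp add: j_def algebra_simps)
    finally show ?thesis unfolding fy using False by (simp add: j_def algebra_simps)
  qed
qed

end

section \<open>Assembly of the vanishing criterion and the four ranges\<close>

theorem theorem1p1:
  fixes m n t k k1 :: nat and A A1 B c1 c2 Rinv :: int
    and chi1 chi2 :: "int \<Rightarrow> complex"
    and N :: nat and S :: complex and C :: "int \<Rightarrow> int"
  assumes hm: "m \<ge> 3"
    and hchi1: "dchar (2 ^ m) chi1"
    and hchi2: "primitive_dchar (2 ^ m) chi2"
    and hk: "k \<ge> 1"
    and hA: "A = 2 ^ n * A1" and hn: "n > 0"
    and hkt: "k = 2 ^ t * k1"
    and hodd: "odd A1" "odd k1" "odd B"
    and hc1: "chi1 5 = eq (2 ^ (m - 2)) c1" "1 \<le> c1" "c1 \<le> 2 ^ (m - 2)"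
    and hc2: "chi2 5 = eq (2 ^ (m - 2)) c2" "1 \<le> c2" "c2 \<le> 2 ^ (m - 2)"
    and hS: "S = (\<Sum>x\<in>{1..2 ^ m}. chi1 x * chi2 (A * x ^ k + B))"
    and hN: "N = (if m - n > 2 * t + 4 then (m - n + 1) div 2 else t + 2)"
    and hRinv: "[R (N + n) * Rinv = 1] (mod 2 ^ m)"
    and hC: "C = (\<lambda>x. c1 * (A * x ^ k + B) + c2 * A * int k * x ^ k * R N * Rinv)"
    and hmn: "m - n \<ge> t + 2"
  shows
    "(\<not> ((\<exists>c3. odd c3 \<and> c1 = 2 ^ (n + t) * c3)
          \<and> (even k \<longrightarrow> chi1 (-1) = 1)
          \<and> (m - n > 2 * t + 4 \<longrightarrow>
               (\<exists>x0. odd (x0 * (A * x0 ^ k + B)) \<and>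
                  [C x0 = 0] (mod 2 ^ ((m + n) div 2 + t))))) \<longrightarrow> S = 0)
     \<and>
     (((\<exists>c3. odd c3 \<and> c1 = 2 ^ (n + t) * c3)
          \<and> (even k \<longrightarrow> chi1 (-1) = 1)
          \<and> (m - n > 2 * t + 4 \<longrightarrow>
               (\<exists>x0. odd (x0 * (A * x0 ^ k + B)) \<and>
                  [C x0 = 0] (mod 2 ^ ((m + n) div 2 + t))))) \<longrightarrow>
       (m - n > 2 * t + 4 \<longrightarrow>
          (\<forall>x0 lam. odd (x0 * (A * x0 ^ k + B)) \<and> C x0 = lam * 2 ^ ((m + n) div 2 + t) \<longrightarrow>
             (let c3 = c1 div 2 ^ (n + t);
                  h = 2 * lam + (int k1 - 1) + (2 ^ n - 1) * c3;
                  \<omega> = exp (\<i> * of_real pi / 4)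
              in S = of_real (2 powr (real (m + n) / 2 + real t + real (min 1 t)))
                      * chi1 x0 * chi2 (A * x0 ^ k + B)
                      * (if even (m - n) then 1 else \<omega> powi h * of_int (jacobi 2 h)))))
       \<and>
       (t + 3 < m - n \<and> m - n \<le> 2 * t + 4 \<longrightarrow>
          S = (if even k \<and> [C 1 = 0] (mod 2 ^ (m - 2)) then 2 ^ (m - 1) * chi2 (A + B)
               else if odd k \<and> [C 1 = 0] (mod 2 ^ (m - 2)) then 2 ^ (m - 2) * chi2 (A + B)
               else if odd k \<and> [C (-1) = 0] (mod 2 ^ (m - 2))
                 then 2 ^ (m - 2) * chi1 (-1) * chi2 (- A + B)
               else 0))
       \<and>
       (m - n = t + 3 \<longrightarrow>
          S = (if even k \<and> (chi1 5 = 1 \<or> chi1 5 = -1) \<and> chi1 (-1) = 1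
                 then 2 ^ (m - 1) * chi2 (A + B)
               else if odd k \<and> (chi1 5 = 1 \<or> chi1 5 = -1)
                 then 2 ^ (m - 2) * (chi2 (A + B) + chi1 (-1) * chi2 (- A + B))
               else 0))
       \<and>
       (m - n = t + 2 \<longrightarrow>
          S = (if (even k \<and> chi1 = chi0_2) \<or> (odd k \<and> chi1 = chi4)
                 then 2 ^ (m - 1) * chi2 (A + B) else 0)))"
proof -
  interpret T: two_power_sum m n t k k1 N A A1 B c1 c2 Rinv chi1 chi2
  proof unfold_locales
    show "dchar (2 ^ m) chi2" using hchi2 by (simp add: primitive_dchar_def)
    show "odd c2" by (rule primitive_dchar_exponent_odd[OF hm hchi2 hc2(1)])
    show "t + 2 \<le> N" "N + n \<le> m" "m \<le> 2 * N + n" using hN hmn by (auto split: if_splits)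
  qed fact+
  have TS: "T.S = S" by (simp add: hS T.S_def T.f_def)
  have TC: "T.C = C" by (intro ext) (simp add: hC T.C_def)
  have odd_iff: "odd (x * (A * x ^ k + B)) \<longleftrightarrow> odd x" for x
    using T.odd_argument[of x] by simp
  have modulus: "(m + n) div 2 + t = m - (N - t)" if "m - n > 2 * t + 4"
  proof -
    have N: "N = (m - n + 1) div 2" using hN that by simp
    \<comment> \<open>\<open>N\<close> is half of \<open>m - n\<close> rounded up, so
      \<open>m - N\<close> is half of \<open>m + n\<close> rounded down.\<close>
    have "(m + n) div 2 = m - N" unfolding N using that by presburger
    then show ?thesis using T.N_ge T.N_le by simp
  qed
  show ?thesis (is "(\<not> ?P \<longrightarrow> _) \<and> (?P \<longrightarrow> ?i \<and> ?ii \<and> ?iii \<and> ?iv)")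
  proof (rule conjI)
    show "\<not> ?P \<longrightarrow> S = 0"
    proof (rule impI, rule ccontr)
      assume "\<not> ?P" "S \<noteq> 0"
      then obtain a where a: "odd a" "2 ^ (m - (N - t)) dvd T.C a"
        using T.S_nonzero_imp_solution TS by metis
      have "\<exists>c3. odd c3 \<and> c1 = 2 ^ (n + t) * c3"
      proof (cases "N + n < m")
        case True
        then show ?thesis using T.solution_imp_c1_exact[OF a] by simp
      next
        case False
        \<comment> \<open>Equality \<open>N + n = m\<close> occurs only for
          \<open>m - n = t + 2\<close>. Then \<open>2 ^ (m - 2)\<close> divides \<open>c1\<close>,
          and the range of \<open>c1\<close> forces equality, so \<open>c3 = 1\<close>.\<close>
        then have "m - 2 = n + t" using hN hmn hn by (auto split: if_splits)
        then have "c1 = 2 ^ (n + t)"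
          using T.solution_imp_dvd_c1[OF a] hc1(2,3) zdvd_imp_le[of "2 ^ (n + t)" c1] by simp
        then show ?thesis by (intro exI[of _ 1]) simp
      qed
      moreover have "even k \<longrightarrow> chi1 (- 1) = 1"
        using T.S_eq_0_if_chi1_odd TS \<open>S \<noteq> 0\<close> by auto
      moreover have "\<exists>x0. odd (x0 * (A * x0 ^ k + B)) \<and> [C x0 = 0] (mod 2 ^ ((m + n) div 2 + t))"
        if "m - n > 2 * t + 4"
        using a unfolding odd_iff modulus[OF that] TC by (auto simp: cong_0_iff)
      ultimately show False using \<open>\<not> ?P\<close> by blast
    qed
    show "?P \<longrightarrow> ?i \<and> ?ii \<and> ?iii \<and> ?iv"
    proof
      assume P: ?P
      then obtain c3 where c3: "c1 = 2 ^ (n + t) * c3" "odd c3" by blast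
      have even_k: "chi1 (- 1) = 1" if "even k" using P that by blast
      have N: "N = t + 2" if "m - n \<le> 2 * t + 4" using hN that by simp
      have ?i
      proof (intro impI allI, elim conjE)
        fix x0 lam
        assume L: "m - n > 2 * t + 4" and "odd (x0 * (A * x0 ^ k + B))"
          and "C x0 = lam * 2 ^ ((m + n) div 2 + t)"
        then have x0: "odd x0" "T.C x0 = lam * 2 ^ (m - (N - t))"
          using odd_iff modulus[OF L] TC by metis+
        define h where "h = 2 * lam + (int k1 - 1) + (2 ^ n - 1) * c3"
        have "odd h" using c3(2) hodd(2) hn by (simp add: h_def)
        have c3': "c1 div 2 ^ (n + t) = c3" by (simp add: c3(1))
        have NL: "N = (m - n + 1) div 2" using hN L by simp
        have exp: "m - (N - t) = m - N + t" using T.N_ge T.N_le by simp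
        have "S = of_real (2 powr (real (m + n) / 2 + real t + real (min 1 t)))
            * T.f x0 * (if even (m - n) then 1
                else exp (\<i> * of_real pi / 4) powi h * of_int (jacobi 2 h))"
        proof (cases "even (m - n)")
          case True
          then have "m - n = 2 * N" unfolding NL by presburger
          then have "m + n = 2 * (m - N)" using T.N_le by linarith
          then have "real (m + n) / 2 + real t + real (min 1 t) = real (m - (N - t) + min 1 t)"
            unfolding exp by simp
          then have "2 powr (real (m + n) / 2 + real t + real (min 1 t)) = 2 ^ (m - (N - t) + min 1 t)"
            by (simp only: powr_realpow zero_less_numeral)
          moreover have "S = 2 ^ (m - (N - t) + min 1 t) * T.f x0"
            using T.S_even_case[OF c3(1) \<open>m - n = 2 * N\<close> x0(1) _ even_k] x0(2) TS by simp
          ultimately show ?thesis using True by simp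
        next
          case False
          then have mN: "m = n + 2 * N - 1" "N \<ge> t + 3" using L unfolding NL by presburger+
          then have "m + n = 2 * (m - N) + 1" using T.N_le by linarith
          \<comment> \<open>The extra half in the exponent supplies the \<open>sqrt 2\<close> of
            \<open>sqrt2_omega_jacobi\<close>.\<close>
          then have "real (m + n) / 2 + real t + real (min 1 t) = real (m - (N - t) + min 1 t) + 1 / 2"
            unfolding exp by simp
          then have "2 powr (real (m + n) / 2 + real t + real (min 1 t)) = 2 ^ (m - (N - t) + min 1 t) * sqrt 2"
            by (simp only: powr_add powr_realpow zero_less_numeral powr_half_sqrt[of 2, simplified])
          moreover have "S = 2 ^ (m - (N - t) + min 1 t) * T.f x0 * (1 + eq 4 h)"
            using T.S_odd_case[OF c3 mN x0 even_k] TS by (simp add: h_def)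
          ultimately show ?thesis
            using False sqrt2_omega_jacobi[OF \<open>odd h\<close>] by (simp add: mult_ac)
        qed
        then show "let c3 = c1 div 2 ^ (n + t);
              h = 2 * lam + (int k1 - 1) + (2 ^ n - 1) * c3;
              \<omega> = exp (\<i> * of_real pi / 4)
            in S = of_real (2 powr (real (m + n) / 2 + real t + real (min 1 t)))
                  * chi1 x0 * chi2 (A * x0 ^ k + B)
                  * (if even (m - n) then 1 else \<omega> powi h * of_int (jacobi 2 h))"
          unfolding Let_def c3' h_def[symmetric] T.f_def by (simp only: mult.assoc)
      qed
      moreover have ?ii
      proof (intro impI, elim conjE)
        assume L: "t + 3 < m - n" "m - n \<le> 2 * t + 4"
        have "2 ^ (n + t) dvd c1" by (simp add: c3(1))
        from T.S_middle_range[OF N[OF L(2)] L(1) this even_k]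
        show "S = (if even k \<and> [C 1 = 0] (mod 2 ^ (m - 2)) then 2 ^ (m - 1) * chi2 (A + B)
               else if odd k \<and> [C 1 = 0] (mod 2 ^ (m - 2)) then 2 ^ (m - 2) * chi2 (A + B)
               else if odd k \<and> [C (-1) = 0] (mod 2 ^ (m - 2))
                 then 2 ^ (m - 2) * chi1 (-1) * chi2 (- A + B)
               else 0)"
          unfolding TS TC .
      qed
      moreover have ?iii
      proof
        assume L: "m - n = t + 3"
        then have "N = t + 2" by (intro N) simp
        from T.S_t_plus_3[OF L this c3 even_k]
        show "S = (if even k \<and> (chi1 5 = 1 \<or> chi1 5 = -1) \<and> chi1 (-1) = 1
                 then 2 ^ (m - 1) * chi2 (A + B)
               else if odd k \<and> (chi1 5 = 1 \<or> chi1 5 = -1)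
                 then 2 ^ (m - 2) * (chi2 (A + B) + chi1 (-1) * chi2 (- A + B))
               else 0)"
          unfolding TS .
      qed
      moreover have ?iv
      proof
        assume L: "m - n = t + 2"
        then have "N = t + 2" by (intro N) simp
        moreover have "2 ^ (n + t) dvd c1" by (simp add: c3(1))
        ultimately show "S = (if (even k \<and> chi1 = chi0_2) \<or> (odd k \<and> chi1 = chi4)
                 then 2 ^ (m - 1) * chi2 (A + B) else 0)"
          using T.S_t_plus_2[OF L _ _ even_k] unfolding TS by blast
      qed
      ultimately show "?i \<and> ?ii \<and> ?iii \<and> ?iv" by blast
    qed
  qed
qed

end
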